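(* Let $d\ge2$, $\{r_n\}\subset(0,1)$ and $\{s_n\}\subset(1,+\infty)$ with $r_n\to0^+$ and $s_n\to1^+$. Let $\{E_n\}\subset\mathfrak{C}$ with $E_n\to E$ in $\mathfrak{C}$ for some $E\in\mathfrak{C}$. Then for every $x\in\partial E\cap\partial E_n$ for all $n$, $$\lim_{n\to\infty}\frac{\mathcal K^{s_n}_{r_n}(x,E_n)}{\beta(r_n,s_n)}=\omega_{d-1}\mathcal K^1(x,E).$$
   Context: $\mathfrak{C}$ is the class of subsets of $\mathbb{R}^d$ which are closures of open sets with compact $C^2$ boundary; $E_n\to E$ in $\mathfrak{C}$ means there are diffeomorphisms $\Phi_n$ converging to the identity in $C^2$ with $\Phi_n(E)=E_n$. $k^s_r(t)=r^{-d-s}$ for $0\le t\le r$ and $k^s_r(t)=t^{-d-s}$ for $t>r$; $\mathcal K^s_r(x,E):=\int_{\mathbb{R}^d}(\chi_{\mathbb{R}^d\setminus E}(y)-\chi_E(y))k^s_r(|x-y|)\,dy$. $\beta(r,s):=\frac{d+s}{d+1}\frac{r^{1-s}-1}{s-1}+\frac1{d+1}$. $\omega_{d-1}$ is the measure of the unit ball of $\mathbb{R}^{d-1}$; $\mathcal K^1$ is the classical scalar mean curvature (sum of principal curvatures, positive on balls). *)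

theory Defs
  imports "HOL-Analysis.Analysis"
begin

definition C2_on :: "'a::euclidean_space set \<Rightarrow> ('a \<Rightarrow> 'b::real_normed_vector) \<Rightarrow> bool" where
  "C2_on U f \<longleftrightarrow> (\<exists>(Df :: 'a \<Rightarrow> ('a \<Rightarrow>\<^sub>L 'b)) (D2f :: 'a \<Rightarrow> ('a \<Rightarrow>\<^sub>L ('a \<Rightarrow>\<^sub>L 'b))).
      (\<forall>y\<in>U. (f has_derivative blinfun_apply (Df y)) (at y)
            \<and> (Df has_derivative blinfun_apply (D2f y)) (at y))
      \<and> continuous_on U D2f)"

definition local_defining ::
  "'a::euclidean_space set \<Rightarrow> 'a \<Rightarrow> real \<Rightarrow> ('a \<Rightarrow> real) \<Rightarrow> ('a \<Rightarrow> ('a \<Rightarrow>\<^sub>L real))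
     \<Rightarrow> ('a \<Rightarrow> ('a \<Rightarrow>\<^sub>L ('a \<Rightarrow>\<^sub>L real))) \<Rightarrow> bool" where
  "local_defining E x \<rho> \<phi> D\<phi> D2\<phi> \<longleftrightarrow>
     \<rho> > 0
     \<and> (\<forall>y\<in>ball x \<rho>. (\<phi> has_derivative blinfun_apply (D\<phi> y)) (at y)
                    \<and> (D\<phi> has_derivative blinfun_apply (D2\<phi> y)) (at y)
                    \<and> D\<phi> y \<noteq> 0)
     \<and> continuous_on (ball x \<rho>) D2\<phi>
     \<and> E \<inter> ball x \<rho> = {y \<in> ball x \<rho>. \<phi> y \<le> 0}"

definition classC :: "'a::euclidean_space set set" where
  "classC = {E. (\<exists>U. open U \<and> E = closure U) \<and> compact (frontier E)
               \<and> (\<forall>x\<in>frontier E. \<exists>\<rho> \<phi> D\<phi> D2\<phi>. local_defining E x \<rho> \<phi> D\<phi> D2\<phi>)}"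

definition gradient_of :: "('a::euclidean_space \<Rightarrow>\<^sub>L real) \<Rightarrow> 'a" where
  "gradient_of L = (\<Sum>b\<in>Basis. blinfun_apply L b *\<^sub>R b)"

text \<open>Scalar mean curvature (sum of principal curvatures) computed from a defining function:
  trace of the Hessian projected on the tangent space, divided by the gradient length,
  i.e. div (grad phi / |grad phi|); positive on balls.\<close>
definition curv_formula :: "('a::euclidean_space \<Rightarrow>\<^sub>L real) \<Rightarrow> ('a \<Rightarrow>\<^sub>L ('a \<Rightarrow>\<^sub>L real)) \<Rightarrow> real" where
  "curv_formula D H =
     (let g = gradient_of D; \<nu> = (1 / norm g) *\<^sub>R g in
       ((\<Sum>b\<in>Basis. blinfun_apply (blinfun_apply H b) b) - blinfun_apply (blinfun_apply H \<nu>) \<nu>) / norm g)"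

definition mean_curv :: "'a::euclidean_space \<Rightarrow> 'a set \<Rightarrow> real" where
  "mean_curv x E = (SOME K. \<exists>\<rho> \<phi> D\<phi> D2\<phi>. local_defining E x \<rho> \<phi> D\<phi> D2\<phi>
                              \<and> K = curv_formula (D\<phi> x) (D2\<phi> x))"

definition convC :: "(nat \<Rightarrow> 'a::euclidean_space set) \<Rightarrow> 'a set \<Rightarrow> bool" where
  "convC En E \<longleftrightarrow>
     (\<exists>(\<Phi> :: nat \<Rightarrow> 'a \<Rightarrow> 'a) (D\<Phi> :: nat \<Rightarrow> 'a \<Rightarrow> ('a \<Rightarrow>\<^sub>L 'a)) (D2\<Phi> :: nat \<Rightarrow> 'a \<Rightarrow> ('a \<Rightarrow>\<^sub>L ('a \<Rightarrow>\<^sub>L 'a))).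
        (\<forall>n. bij (\<Phi> n) \<and> C2_on UNIV (inv (\<Phi> n))
             \<and> (\<forall>y. (\<Phi> n has_derivative blinfun_apply (D\<Phi> n y)) (at y)
                  \<and> (D\<Phi> n has_derivative blinfun_apply (D2\<Phi> n y)) (at y))
             \<and> continuous_on UNIV (D2\<Phi> n)
             \<and> \<Phi> n ` E = En n)
      \<and> (\<forall>\<epsilon>>0. \<forall>\<^sub>F n in sequentially. \<forall>y.
            norm (\<Phi> n y - y) \<le> \<epsilon> \<and> norm (D\<Phi> n y - id_blinfun) \<le> \<epsilon> \<and> norm (D2\<Phi> n y) \<le> \<epsilon>))"

definition kern :: "nat \<Rightarrow> real \<Rightarrow> real \<Rightarrow> real \<Rightarrow> real" where
  "kern d s r t = (if t \<le> r then r powr (-(real d + s)) else t powr (-(real d + s)))"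

definition Kcurv :: "real \<Rightarrow> real \<Rightarrow> 'a::euclidean_space \<Rightarrow> 'a set \<Rightarrow> real" where
  "Kcurv s r x E = (\<integral>y. (indicator (- E) y - indicator E y) * kern DIM('a) s r (norm (x - y)) \<partial>lborel)"

definition beta :: "nat \<Rightarrow> real \<Rightarrow> real \<Rightarrow> real" where
  "beta d r s = (real d + s) / (real d + 1) * ((r powr (1 - s) - 1) / (s - 1)) + 1 / (real d + 1)"

end

theory Submission
  imports Defs
begin

text \<open>
  For \<open>t \<ge> 0\<close> the truncated kernel is a superposition of indicators of balls: with \<open>p = d + s\<close>,
  \<open>k(t) = \<integral>\<^sub>r\<^sup>\<infinity> p u\<^bsup>-p-1\<^esup> 1[t \<le> u] du\<close>. Hence the nonlocal curvature is
  \<open>\<integral>\<^sub>r\<^sup>\<infinity> p u\<^bsup>-p-1\<^esup> V(u) du\<close>, where \<open>V(u)\<close> is the volume of the part of the ball \<open>B\<^sub>u(x)\<close> outside the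
  set minus the volume of the part inside it. A second order expansion of the defining functions
  \<open>\<phi> \<circ> \<Phi>\<^sub>n\<^sup>-\<^sup>1\<close>, uniform in \<open>n\<close>, gives \<open>V(u) = (c + o(1)) u\<^bsup>d+1\<^esup>\<close> with
  \<open>c = \<omega>\<^bsub>d-1\<^esub> K\<^sup>1 / (d + 1)\<close>: after rescaling to the unit ball the half-space part cancels by
  symmetry, and the quadratic part contributes its integral over the unit ball of the tangent
  hyperplane. Since \<open>p \<integral>\<^sub>r\<^sup>1 u\<^bsup>-s\<^esup> du = (d + 1) \<beta>(r,s) - 1\<close> and \<open>\<beta>(r,s) \<rightarrow> \<infinity>\<close>, the region where \<open>u\<close> is
  not small is negligible and the quotient tends to \<open>c (d + 1)\<close>.
\<close>

subsection \<open>Invariance of Lebesgue measure under reflections\<close>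

text \<open>The boundary is never written as a graph. The only geometric input is a sandwich: near
  \<open>x\<close>, the set \<open>En n\<close> contains every x + z with L_n z + Q(z,z)/2 + \<eta>
  |z|^2 < 0, and on it L_n z + Q(z,z)/2 - \<eta> |z|^2 \<le> 0. The Hessian Q is frozen at
  \<open>x\<close> and serves all n, but the linear part L_n has to follow n. Moving its deviation
  from the limit L into the error band would cost order |L_n - L| u^d in V(u), which is not small
  against u^(d+1) for u down to r_n. With L_n kept, the half-space part cancels exactly for each n,
  and only the curvature coefficient has to converge. Slicing is done along a basis vector, while
  the normal of L_n is arbitrary and changes with n. A Householder reflection exchanges the two,
  which is why reflection invariance of Lebesgue measure is settled at the outset. The same
  invariance yields the second moments on the tangent hyperplane.\<close>

text \<open>
  Applying Tonelli to \<open>1\<^sub>B(x) 1\<^sub>A(x + y)\<close> in both orders gives \<open>|B| M(A) = |A| M(B)\<close>.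
\<close>

lemma lborel_eqI_translation_invariant:
  fixes M :: "'a::euclidean_space measure"
  assumes sets_M [measurable_cong]: "sets M = sets borel"
    and sf: "sigma_finite_measure M"
    and shift: "\<And>c. distr M borel ((+) c) = M"
    and ball: "emeasure M (cball 0 1) = emeasure lborel (cball (0::'a) 1)"
  shows "M = lborel"
proof (rule measure_eqI)
  show "sets M = sets lborel" by (simp add: sets_M)
next
  interpret M: sigma_finite_measure M by fact
  interpret pair_sigma_finite lborel M ..
  have shift_M: "(\<integral>\<^sup>+y. f (c + y) \<partial>M) = (\<integral>\<^sup>+y. f y \<partial>M)"
    if [measurable]: "f \<in> borel_measurable borel" for f :: "'a \<Rightarrow> ennreal" and c
    by (subst (2) shift[of c, symmetric], subst nn_integral_distr) simp_all
  have shift_L: "(\<integral>\<^sup>+y. f (c + y) \<partial>lborel) = (\<integral>\<^sup>+y. f y \<partial>lborel)"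
    if [measurable]: "f \<in> borel_measurable borel" for f :: "'a \<Rightarrow> ennreal" and c
    by (subst (2) lborel_distr_plus[of c, symmetric], subst nn_integral_distr) simp_all
  define B :: "'a set" where "B = cball 0 1"
  have [measurable]: "B \<in> sets borel" unfolding B_def by simp
  have B: "emeasure M B = emeasure lborel B" "emeasure lborel B \<noteq> 0" "emeasure lborel B \<noteq> \<infinity>"
    using ball less_imp_neq[OF unit_ball_vol_pos[of "real DIM('a)"]]
    by (auto simp: B_def emeasure_cball)
  fix A assume "A \<in> sets M"
  then have [measurable]: "A \<in> sets borel" by (simp add: sets_M)
  have "emeasure lborel B * emeasure M A
      = (\<integral>\<^sup>+x. indicator B x * (\<integral>\<^sup>+y. indicator A y \<partial>M) \<partial>lborel)"
    by (simp add: nn_integral_multc sets_M)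
  also have "\<dots> = (\<integral>\<^sup>+x. indicator B x * (\<integral>\<^sup>+y. indicator A (x + y) \<partial>M) \<partial>lborel)"
    by (subst shift_M) simp_all
  also have "\<dots> = (\<integral>\<^sup>+x. (\<integral>\<^sup>+y. indicator B x * indicator A (x + y) \<partial>M) \<partial>lborel)"
    by (subst nn_integral_cmult) simp_all
  also have "\<dots> = (\<integral>\<^sup>+y. (\<integral>\<^sup>+x. indicator B x * indicator A (x + y) \<partial>lborel) \<partial>M)"
    by (subst Fubini') simp_all
  also have "\<dots> = (\<integral>\<^sup>+y. (\<integral>\<^sup>+x. indicator B (- y + x) * indicator A x \<partial>lborel) \<partial>M)"
  proof (rule nn_integral_cong)
    fix y
    show "(\<integral>\<^sup>+x. indicator B x * indicator A (x + y) \<partial>lborel)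
        = (\<integral>\<^sup>+x. indicator B (- y + x) * indicator A x \<partial>lborel)"
      by (subst (2) shift_L[symmetric, of _ y]) (simp_all add: add.commute)
  qed
  \<comment> \<open>The test set is a ball because its symmetry about the origin allows -y + x to be
    negated; after the next exchange of integrals a translate of \<open>B\<close> stands in the
    variable of \<open>M\<close>.\<close>
  also have "\<dots> = (\<integral>\<^sup>+y. (\<integral>\<^sup>+x. indicator B (- x + y) * indicator A x \<partial>lborel) \<partial>M)"
    by (intro nn_integral_cong) (auto simp: B_def indicator_def norm_minus_commute)
  also have "\<dots> = (\<integral>\<^sup>+x. (\<integral>\<^sup>+y. indicator A x * indicator B (- x + y) \<partial>M) \<partial>lborel)"
    by (subst Fubini') (simp_all add: mult.commute)
  also have "\<dots> = emeasure lborel A * emeasure M B"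
    using shift_M[of "indicator B" "- x" for x]
    by (simp add: nn_integral_cmult nn_integral_multc sets_M)
  finally show "emeasure M A = emeasure lborel A"
    using B ennreal_mult_cancel_left[of "emeasure lborel B"] by (metis mult.commute infinity_ennreal_def)
qed

text \<open>The Householder reflection in the hyperplane orthogonal to \<open>w\<close>. For
  \<open>w = 0\<close> it is the identity, so a normal that already is the chosen basis vector needs
  no separate treatment.\<close>

definition reflect :: "'a::real_inner \<Rightarrow> 'a \<Rightarrow> 'a"
  where "reflect w z = z - (2 * (z \<bullet> w) / (w \<bullet> w)) *\<^sub>R w"

lemma linear_reflect: "linear (reflect w)"
  unfolding reflect_def by (rule linearI) (auto simp: algebra_simps inner_add_left add_divide_distrib)

lemma inner_reflect_left: "reflect w y \<bullet> z = y \<bullet> reflect w z"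
  by (simp add: reflect_def inner_diff_left inner_diff_right inner_commute)

lemma reflect_reflect [simp]: "reflect w (reflect w z) = z"
proof (cases "w = 0")
  case False
  then have "reflect w z \<bullet> w = - (z \<bullet> w)"
    by (simp add: reflect_def inner_diff_left)
  then show ?thesis by (simp add: reflect_def[of w "reflect w z"]) (simp add: reflect_def)
qed (simp add: reflect_def)

lemma inner_reflect [simp]: "reflect w y \<bullet> reflect w z = y \<bullet> z"
  by (simp add: inner_reflect_left)

lemma norm_reflect [simp]: "norm (reflect w z) = norm z"
  by (simp add: norm_eq_sqrt_inner)

text \<open>Equal norms give |a - b|^2 = 2 a . (a - b), so the coefficient in the reflection is 1
  and a - (a - b) = b remains. It is applied to a unit normal and a basis vector, and to two basis
  vectors.\<close>

lemma reflect_swap: "norm a = norm b \<Longrightarrow> reflect (a - b) a = b"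
proof (cases "a = b")
  case False
  assume n: "norm a = norm b"
  then have "a \<bullet> a = b \<bullet> b" by (simp add: norm_eq)
  then have "(a - b) \<bullet> (a - b) = 2 * (a \<bullet> (a - b))"
    by (simp add: algebra_simps inner_diff_left inner_diff_right inner_commute)
  moreover have "(a - b) \<bullet> (a - b) \<noteq> 0" using False by simp
  ultimately have *: "2 * (a \<bullet> (a - b)) / ((a - b) \<bullet> (a - b)) = 1"
    by (metis divide_self)
  show ?thesis unfolding reflect_def * by simp
qed (simp add: reflect_def)

lemma reflect_borel [measurable]: "reflect (w::'a::euclidean_space) \<in> borel \<rightarrow>\<^sub>M borel"
  unfolding reflect_def by measurable

text \<open>A linear isometry fixes centred balls and carries translations to translations, so the
  image measure meets the uniqueness criterion.\<close>

lemma lborel_distr_reflect: "distr lborel borel (reflect w) = (lborel :: 'a::euclidean_space measure)"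
proof (rule lborel_eqI_translation_invariant)
  let ?M = "distr lborel borel (reflect w) :: 'a measure"
  have vim: "reflect w -` cball 0 n = cball 0 n" for n by (auto simp: dist_norm)
  show "sets ?M = sets borel" by simp
  show "emeasure ?M (cball 0 1) = emeasure lborel (cball (0::'a) 1)"
    by (subst emeasure_distr) (simp_all add: vim)
  show "sigma_finite_measure ?M"
  proof
    show "\<exists>A. countable A \<and> A \<subseteq> sets ?M \<and> \<Union> A = space ?M \<and> (\<forall>a\<in>A. emeasure ?M a \<noteq> \<infinity>)"
    proof (intro exI conjI ballI)
      show "countable (range (\<lambda>n. cball (0::'a) (real n)))" by simp
      show "\<Union> (range (\<lambda>n. cball (0::'a) (real n))) = space ?M"
        by (auto simp: real_arch_simple)
      fix a assume "a \<in> range (\<lambda>n. cball (0::'a) (real n))"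
      then show "emeasure ?M a \<noteq> \<infinity>"
        by (auto simp: emeasure_distr vim emeasure_cball)
    qed auto
  qed
  fix c :: 'a
  have "distr ?M borel ((+) c) = distr lborel borel (\<lambda>z. c + reflect w z)"
    by (subst distr_distr) (simp_all add: o_def)
  \<comment> \<open>Linearity and the involution property turn the translation by \<open>c\<close>
    after the reflection into a translation by \<open>reflect w c\<close> before it.\<close>
  also have "(\<lambda>z. c + reflect w z) = reflect w \<circ> (+) (reflect w c)"
    by (auto simp: linear_add[OF linear_reflect])
  also have "distr lborel borel \<dots> = distr (distr lborel borel ((+) (reflect w c))) borel (reflect w)"
    by (subst distr_distr) simp_all
  also have "\<dots> = ?M" by (simp add: lborel_distr_plus)
  finally show "distr ?M borel ((+) c) = ?M" .
qed

lemma lborel_integral_reflect: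
  fixes f :: "'a::euclidean_space \<Rightarrow> real"
  assumes [measurable]: "f \<in> borel_measurable borel"
  shows "(\<integral>z. f (reflect w z) \<partial>lborel) = (\<integral>z. f z \<partial>lborel)"
  by (subst (2) lborel_distr_reflect[of w, symmetric], subst integral_distr) simp_all

subsection \<open>Slicing along a basis vector\<close>

text \<open>The argument is a coordinate function rather than a vector, to match the product measure
  over \<open>Basis\<close> from which Lebesgue measure arises.\<close>

definition slice_pt :: "'a::euclidean_space \<Rightarrow> ('a \<Rightarrow> real) \<Rightarrow> 'a"
  where "slice_pt b y = (\<Sum>i\<in>Basis - {b}. y i *\<^sub>R i)"

definition flat :: "'a::real_inner \<Rightarrow> 'a \<Rightarrow> 'a"
  where "flat b z = z - (z \<bullet> b) *\<^sub>R b"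

abbreviation slice_measure :: "'a::euclidean_space \<Rightarrow> ('a \<Rightarrow> real) measure"
  where "slice_measure b \<equiv> Pi\<^sub>M (Basis - {b}) (\<lambda>_. lborel)"

text \<open>
  Integrals over the unit ball of the hyperplane orthogonal to \<open>b\<close> are expressed as integrals over
  the cylinder of height 2 above it, so that they inherit the invariance of Lebesgue measure under
  reflections fixing \<open>b\<close>.
\<close>

definition cyl :: "'a::real_inner \<Rightarrow> 'a set"
  where "cyl b = {z. \<bar>z \<bullet> b\<bar> \<le> 1 \<and> norm (flat b z) \<le> 1}"

text \<open>A non-integrable \<open>f\<close> has Bochner integral 0, so only the bound has to be
  integrable. This spares measurability arguments for inner integrals regarded as functions of the
  slice.\<close>

lemma integral_abs_le:
  fixes f g :: "'a \<Rightarrow> real"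
  assumes g: "integrable M g" and le: "\<And>x. x \<in> space M \<Longrightarrow> \<bar>f x\<bar> \<le> g x"
  shows "\<bar>\<integral>x. f x \<partial>M\<bar> \<le> (\<integral>x. g x \<partial>M)"
proof (cases "integrable M f")
  case True
  have "\<bar>\<integral>x. f x \<partial>M\<bar> \<le> (\<integral>x. \<bar>f x\<bar> \<partial>M)" by (rule integral_abs_bound)
  also have "\<dots> \<le> (\<integral>x. g x \<partial>M)" using True g le by (intro integral_mono) auto
  finally show ?thesis .
next
  case False
  have "0 \<le> (\<integral>x. g x \<partial>M)"
    using le by (intro Bochner_Integration.integral_nonneg) (meson abs_ge_zero order_trans)
  then show ?thesis using False by (simp add: not_integrable_integral_eq)
qed

lemma slice_pt_inner:
  assumes "b \<in> Basis" shows "slice_pt b y \<bullet> b = 0"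
  using assms by (auto simp: slice_pt_def inner_sum_left inner_Basis intro!: sum.neutral)

lemma norm_slice_pt: "norm (slice_pt b y) = sqrt (\<Sum>i\<in>Basis - {b}. (y i)\<^sup>2)"
proof -
  have "(norm (slice_pt b y))\<^sup>2 = (\<Sum>i\<in>Basis - {b}. (norm (y i *\<^sub>R i))\<^sup>2)"
    unfolding slice_pt_def
    by (rule norm_sum_Pythagorean) (auto simp: pairwise_def orthogonal_def inner_Basis)
  then show ?thesis by (simp add: real_sqrt_unique sum_nonneg)
qed

lemma slice_pt_borel [measurable]: "slice_pt b \<in> slice_measure b \<rightarrow>\<^sub>M borel"
  unfolding slice_pt_def by measurable

lemma flat_borel [measurable]: "flat (b::'a::euclidean_space) \<in> borel \<rightarrow>\<^sub>M borel"
  unfolding flat_def by measurable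

lemma flat_slice: "b \<in> Basis \<Longrightarrow> flat b (slice_pt b y + h *\<^sub>R b) = slice_pt b y"
  by (simp add: flat_def inner_add_left slice_pt_inner)

lemma norm_flat: "norm b = 1 \<Longrightarrow> (norm z)\<^sup>2 = (norm (flat b z))\<^sup>2 + (z \<bullet> b)\<^sup>2"
  by (simp add: flat_def power2_norm_eq_inner inner_diff_left inner_diff_right inner_commute)
    (simp add: norm_eq_1 power2_eq_square)

lemma cyl_borel [measurable]: "cyl (b::'a::euclidean_space) \<in> sets borel"
  unfolding cyl_def by measurable

lemma cyl_subset_cball: "norm b = 1 \<Longrightarrow> cyl b \<subseteq> cball 0 2"
proof
  fix z assume b: "norm b = 1" and "z \<in> cyl b"
  then have "\<bar>z \<bullet> b\<bar> \<le> 1" "norm (flat b z) \<le> 1" by (auto simp: cyl_def)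
  moreover have "norm z \<le> norm (flat b z) + norm ((z \<bullet> b) *\<^sub>R b)"
    using norm_triangle_ineq[of "flat b z" "(z \<bullet> b) *\<^sub>R b"] by (simp add: flat_def)
  ultimately show "z \<in> cball 0 2" using b by simp
qed

lemma slice_integral:
  fixes f :: "'a::euclidean_space \<Rightarrow> real"
  assumes b: "b \<in> Basis" and f: "integrable lborel f"
  shows "(\<integral>z. f z \<partial>lborel) = (\<integral>y. (\<integral>h. f (slice_pt b y + h *\<^sub>R b) \<partial>lborel) \<partial>slice_measure b)"
proof -
  interpret product_sigma_finite "\<lambda>_::'a. lborel :: real measure" by standard
  let ?T = "\<lambda>y. \<Sum>i\<in>Basis. y i *\<^sub>R (i::'a)"
  have Bas: "Basis = insert b (Basis - {b})" using b by auto
  have [measurable]: "f \<in> borel_measurable borel" using f by auto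
  have T [measurable]: "?T \<in> Pi\<^sub>M Basis (\<lambda>_. lborel) \<rightarrow>\<^sub>M borel" by measurable
  have int: "integrable (Pi\<^sub>M Basis (\<lambda>_. lborel)) (\<lambda>y. f (?T y))"
    using f by (subst (asm) lborel_eq) (simp add: integrable_distr_eq)
  have T_upd: "?T (y(b := h)) = slice_pt b y + h *\<^sub>R b" for y h
    using b by (subst Bas, subst sum.insert) (auto simp: slice_pt_def intro!: sum.cong)
  have "(\<integral>z. f z \<partial>lborel) = (\<integral>y. f (?T y) \<partial>Pi\<^sub>M Basis (\<lambda>_. lborel))"
    by (subst lborel_eq, subst integral_distr) simp_all
  also have "\<dots> = (\<integral>y. f (?T y) \<partial>Pi\<^sub>M (insert b (Basis - {b})) (\<lambda>_. lborel))"
    using Bas by simp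
  also have "\<dots> = (\<integral>y. (\<integral>h. f (?T (y(b := h))) \<partial>lborel) \<partial>slice_measure b)"
    using int Bas by (intro product_integral_insert) simp_all
  finally show ?thesis unfolding T_upd .
qed

lemma emeasure_slice_ball:
  fixes b :: "'a::euclidean_space"
  assumes "b \<in> Basis" "r \<ge> 0" "DIM('a) \<ge> 2"
  shows "emeasure (slice_measure b) {y \<in> space (slice_measure b). norm (slice_pt b y) \<le> r}
     = ennreal (unit_ball_vol (real (DIM('a) - 1)) * r ^ (DIM('a) - 1))"
proof -
  have card: "card (Basis - {b}) = DIM('a) - 1" using assms by simp
  have pos: "emeasure (slice_measure b) {y \<in> space (slice_measure b). norm (slice_pt b y) \<le> r}
     = ennreal (unit_ball_vol (real (DIM('a) - 1)) * r ^ (DIM('a) - 1))" if "r > 0" for r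
  proof -
    have "{y \<in> space (slice_measure b). norm (slice_pt b y) \<le> r}
        = {f. sqrt (\<Sum>i\<in>Basis - {b}. (f i)\<^sup>2) \<le> r} \<inter> space (slice_measure b)"
      by (auto simp: norm_slice_pt)
    then show ?thesis using emeasure_cball_aux[of "Basis - {b}" r] that card by simp
  qed
  show ?thesis
  proof (cases "r = 0")
    case True
    define w where "w = unit_ball_vol (real (DIM('a) - 1))"
    let ?e = "emeasure (slice_measure b) {y \<in> space (slice_measure b). norm (slice_pt b y) \<le> 0}"
    \<comment> \<open>Balls of radius 1/(n+1) enclose the set of radius 0; their volumes tend to w
      0^(d-1), which is 0 for d \<ge> 2.\<close>
    have le: "?e \<le> ennreal (w * (1 / real (Suc n)) ^ (DIM('a) - 1))" for n
      unfolding w_def by (subst pos[symmetric]) (auto intro!: emeasure_mono)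
    have "(\<lambda>n. ennreal (w * (1 / real (Suc n)) ^ (DIM('a) - 1))) \<longlonglongrightarrow> ennreal (w * 0 ^ (DIM('a) - 1))"
      by (intro tendsto_intros LIMSEQ_Suc lim_1_over_n)
    then have "?e \<le> ennreal (w * 0 ^ (DIM('a) - 1))"
      using le by (intro LIMSEQ_le_const) auto
    then show ?thesis using True assms by (simp add: power_0_left)
  qed (use pos assms in simp)
qed

section \<open>Signed volume of a slightly perturbed half ball\<close>

lemma integrable_bounded_support:
  fixes f :: "'a::euclidean_space \<Rightarrow> real"
  assumes [measurable]: "f \<in> borel_measurable borel" and le: "\<And>z. \<bar>f z\<bar> \<le> B * indicator (cball c R) z"
  shows "integrable lborel f"
proof (rule Bochner_Integration.integrable_bound)
  show "integrable lborel (\<lambda>z. B * indicator (cball c R) z)"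
    using emeasure_bounded_finite[of "cball c R"] by (intro integrable_mult_right integrable_real_indicator) auto
  show "AE z in lborel. norm (f z) \<le> norm (B * indicator (cball c R) z)"
    using le by (auto intro!: AE_I2 order_trans[OF le])
qed simp

text \<open>One slice of the perturbed half ball. On the chord [-l, l] the set \<open>A\<close> is
  squeezed between half lines ending at -t (a + e) and -t (a - e). If the point -t a lies in the
  chord, the signed length is 2 t a up to 2 t e. Since |t a| \<le> t m, that point can leave the
  chord only if l < t m, and then clipping costs at most another 2 t m.\<close>

lemma interval_sign_integral:
  fixes A :: "real set"
  assumes [measurable]: "A \<in> sets borel" and l: "0 \<le> l" and t: "t \<ge> 0" and e: "e \<ge> 0" and a: "\<bar>a\<bar> \<le> m"
    and inA: "\<And>h. \<bar>h\<bar> \<le> l \<Longrightarrow> h + t * (a + e) < 0 \<Longrightarrow> h \<in> A"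
    and outA: "\<And>h. \<bar>h\<bar> \<le> l \<Longrightarrow> h \<in> A \<Longrightarrow> h + t * (a - e) \<le> 0"
  shows "\<bar>(\<integral>h. (indicator (- A) h - indicator A h) * indicator {-l..l} h \<partial>lborel) - 2 * t * a\<bar>
     \<le> 2 * t * e + (if l < t * m then 2 * t * m else 0)"
proof -
  let ?s = "\<lambda>h. (indicator (- A) h - indicator A h) * indicator {-l..l} h :: real"
  \<comment> \<open>\<open>?s\<close> lies between two step functions whose integrals are the clipped values of \<open>2t(a \<plusminus> e)\<close>.\<close>
  let ?up = "\<lambda>h. 2 * indicator {max (-l) (- (t * (a + e)))..l} h - indicator {-l..l} h :: real"
  let ?lo = "\<lambda>h. 2 * indicator {max (-l) (- (t * (a - e)))<..l} h - indicator {-l..l} h :: real"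
  have int: "integrable lborel ?s"
    by (rule integrable_bounded_support[where B = 1 and c = 0 and R = l])
       (auto simp: indicator_def dist_real_def)
  have int_up: "integrable lborel ?up" and int_lo: "integrable lborel ?lo"
    by (rule integrable_bounded_support[where B = 1 and c = 0 and R = l];
        auto simp: indicator_def dist_real_def)+
  have ta: "t * a \<le> t * m" "- (t * m) \<le> t * a" "0 \<le> t * m" "0 \<le> t * e"
    using a t e mult_left_mono[of a m t] mult_left_mono[of "-m" a t]
    by (auto simp: abs_le_iff)
  have "(\<integral>h. ?s h \<partial>lborel) \<le> (\<integral>h. ?up h \<partial>lborel)"
    using inA by (intro integral_mono int int_up) (auto simp: indicator_def algebra_simps split: if_splits)
  also have "\<dots> = 2 * max 0 (l - max (-l) (- (t * (a + e)))) - 2 * l"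
    using l by (auto simp: max_def)
  also have "\<dots> \<le> 2 * t * a + (2 * t * e + (if l < t * m then 2 * t * m else 0))"
    using ta l by (auto simp: max_def algebra_simps)
  finally have 1: "(\<integral>h. ?s h \<partial>lborel) \<le> 2 * t * a + (2 * t * e + (if l < t * m then 2 * t * m else 0))" .
  have "2 * t * a - (2 * t * e + (if l < t * m then 2 * t * m else 0))
      \<le> 2 * max 0 (l - max (-l) (- (t * (a - e)))) - 2 * l"
    using ta l by (auto simp: max_def algebra_simps)
  also have "\<dots> = (\<integral>h. ?lo h \<partial>lborel)"
    using l by (auto simp: max_def)
  also have "\<dots> \<le> (\<integral>h. ?s h \<partial>lborel)"
    using outA by (intro integral_mono int int_lo) (force simp: indicator_def algebra_simps split: if_splits)+
  finally show ?thesis using 1 by linarith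
qed

lemma integral_slice_ball:
  fixes b :: "'a::euclidean_space"
  assumes "b \<in> Basis" "r \<ge> 0" "DIM('a) \<ge> 2"
  shows "integrable (slice_measure b) (\<lambda>y. indicator {y. norm (slice_pt b y) \<le> r} y :: real)"
    and "(\<integral>y. indicator {y. norm (slice_pt b y) \<le> r} y \<partial>slice_measure b)
      = unit_ball_vol (real (DIM('a) - 1)) * r ^ (DIM('a) - 1)"
proof -
  let ?S = "{y \<in> space (slice_measure b). norm (slice_pt b y) \<le> r}"
  have eq: "indicator {y. norm (slice_pt b y) \<le> r} y = (indicator ?S y :: real)"
    if "y \<in> space (slice_measure b)" for y
    using that by (auto simp: indicator_def)
  note em = emeasure_slice_ball[OF assms]
  have "integrable (slice_measure b) (indicator ?S :: _ \<Rightarrow> real)"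
    using em by (intro integrable_real_indicator) simp_all
  then show "integrable (slice_measure b) (\<lambda>y. indicator {y. norm (slice_pt b y) \<le> r} y :: real)"
    using eq by (subst Bochner_Integration.integrable_cong) auto
  have "(\<integral>y. indicator {y. norm (slice_pt b y) \<le> r} y \<partial>slice_measure b)
      = (\<integral>y. (indicator ?S y :: real) \<partial>slice_measure b)"
    using eq by (intro Bochner_Integration.integral_cong) auto
  also have "\<dots> = measure (slice_measure b) ?S" by (simp add: Int_absorb2)
  finally show "(\<integral>y. indicator {y. norm (slice_pt b y) \<le> r} y \<partial>slice_measure b)
      = unit_ball_vol (real (DIM('a) - 1)) * r ^ (DIM('a) - 1)"
    using em assms by (simp add: measure_def)
qed

text \<open>Slicing along \<open>b\<close>, where \<open>p\<close> is constant, leaves the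
  one-dimensional estimate with half chord l = sqrt (1 - |y|^2). The cylinder appears because
  \<open>p\<close> integrates to 2 p along its height, the coefficient of \<open>t\<close> in that
  estimate. Clipping requires l < t m, that is |y| > sqrt (1 - (t m)^2): this annulus next to the
  equator yields the last factor of the bound.\<close>

lemma cap_volume:
  fixes b :: "'a::euclidean_space" and p :: "'a \<Rightarrow> real"
  assumes b: "b \<in> Basis" and d: "DIM('a) \<ge> 2"
    and [measurable]: "F \<in> sets borel" "p \<in> borel_measurable borel"
    and p_flat: "\<And>z. p (flat b z) = p z"
    and p_le: "\<And>z. norm (flat b z) \<le> 1 \<Longrightarrow> \<bar>p z\<bar> \<le> m"
    and t: "0 \<le> t" "t * m \<le> 1" and e: "0 \<le> e" and m: "0 \<le> m"
    and inF: "\<And>z. norm z \<le> 1 \<Longrightarrow> z \<bullet> b + t * (p z + e) < 0 \<Longrightarrow> z \<in> F"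
    and outF: "\<And>z. norm z \<le> 1 \<Longrightarrow> z \<in> F \<Longrightarrow> z \<bullet> b + t * (p z - e) \<le> 0"
  shows "\<bar>(\<integral>z. (indicator (- F) z - indicator F z) * indicator (cball 0 1) z \<partial>lborel)
        - t * (\<integral>z. p z * indicator (cyl b) z \<partial>lborel)\<bar>
      \<le> 2 * t * unit_ball_vol (real (DIM('a) - 1)) * (e + m * (1 - sqrt (1 - (t * m)\<^sup>2) ^ (DIM('a) - 1)))"
proof -
  have nb: "norm b = 1" "b \<bullet> b = 1" using b by (auto simp: inner_Basis)
  let ?s = "\<lambda>z. (indicator (- F) z - indicator F z) * indicator (cball 0 1) z :: real"
  let ?c = "\<lambda>z. p z * indicator (cyl b) z"
  define f where "f z = ?s z - t * ?c z" for z
  define \<rho> where "\<rho> = sqrt (1 - (t * m)\<^sup>2)"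
  have tm: "0 \<le> t * m" using t m by simp
  then have \<rho>: "0 \<le> \<rho>" "\<rho> \<le> 1" using t by (auto simp: \<rho>_def power_le_one)
  have int_s: "integrable lborel ?s"
    by (rule integrable_bounded_support[where B = 1 and c = 0 and R = 1]) (auto simp: indicator_def)
  have int_c: "integrable lborel ?c"
    using cyl_subset_cball[OF nb(1)] p_le m
    by (intro integrable_bounded_support[where B = m and c = 0 and R = 2])
       (auto simp: indicator_def cyl_def)
  have int_f: "integrable lborel f" unfolding f_def using int_s int_c by simp
  \<comment> \<open>The band costs 2 t e on the whole unit disc and clipping costs 2 t m on the
    annulus \<rho> < |y| \<le> 1, written as a difference of discs of known volume.\<close>
  define g where "g y = (2 * t * e + 2 * t * m) * indicator {y. norm (slice_pt b y) \<le> 1} y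
     - 2 * t * m * indicator {y. norm (slice_pt b y) \<le> \<rho>} y" for y
  have g_int: "integrable (slice_measure b) g"
    unfolding g_def using integral_slice_ball(1)[OF b _ d] \<rho>
    by (intro Bochner_Integration.integrable_diff integrable_mult_right) auto
  have g_eq: "(\<integral>y. g y \<partial>slice_measure b) =
     2 * t * unit_ball_vol (real (DIM('a) - 1)) * (e + m * (1 - \<rho> ^ (DIM('a) - 1)))"
    unfolding g_def using integral_slice_ball[OF b _ d] \<rho>
    by (subst Bochner_Integration.integral_diff) (auto simp: algebra_simps)
  have le: "\<bar>\<integral>h. f (slice_pt b y + h *\<^sub>R b) \<partial>lborel\<bar> \<le> g y" for y
  proof (cases "norm (slice_pt b y) \<le> 1")
    case False
    have "f (slice_pt b y + h *\<^sub>R b) = 0" for h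
    proof -
      have "(norm (slice_pt b y + h *\<^sub>R b))\<^sup>2 = (norm (slice_pt b y))\<^sup>2 + h\<^sup>2"
        using norm_flat[OF nb(1), of "slice_pt b y + h *\<^sub>R b"] nb
        by (simp add: flat_slice[OF b] inner_add_left slice_pt_inner[OF b])
      also have "\<dots> > 1" using False one_less_power[of "norm (slice_pt b y)" 2]
        by (smt (verit) zero_le_power2 zero_less_numeral)
      finally have "norm (slice_pt b y + h *\<^sub>R b) > 1"
        by (smt (verit) norm_ge_zero power_le_one)
      then show ?thesis using False by (simp add: f_def cyl_def flat_slice[OF b])
    qed
    moreover have "norm (slice_pt b y) > \<rho>" using False \<rho> by simp
    ultimately show ?thesis using False by (simp add: g_def)
  next
    case True
    define N where "N = norm (slice_pt b y)"
    define l where "l = sqrt (1 - N\<^sup>2)"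
    have N: "0 \<le> N" "N \<le> 1" using True by (auto simp: N_def)
    then have "N\<^sup>2 \<le> 1" by (simp add: power_le_one)
    then have l: "0 \<le> l" "l\<^sup>2 = 1 - N\<^sup>2" "l \<le> 1" by (auto simp: l_def)
    define A where "A = {h. slice_pt b y + h *\<^sub>R b \<in> F}"
    have A [measurable]: "A \<in> sets borel" unfolding A_def by measurable
    have nrm: "(norm (slice_pt b y + h *\<^sub>R b))\<^sup>2 = N\<^sup>2 + h\<^sup>2" for h
      using norm_flat[OF nb(1), of "slice_pt b y + h *\<^sub>R b"] nb
      by (simp add: flat_slice[OF b] inner_add_left slice_pt_inner[OF b] N_def)
    have ball: "norm (slice_pt b y + h *\<^sub>R b) \<le> 1 \<longleftrightarrow> \<bar>h\<bar> \<le> l" for h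
    proof -
      have "norm (slice_pt b y + h *\<^sub>R b) \<le> 1 \<longleftrightarrow> N\<^sup>2 + h\<^sup>2 \<le> 1"
        unfolding nrm[symmetric] by (simp add: abs_square_le_1)
      also have "\<dots> \<longleftrightarrow> h\<^sup>2 \<le> l\<^sup>2" using l by auto
      also have "\<dots> \<longleftrightarrow> \<bar>h\<bar> \<le> l" using l(1) by (simp add: abs_le_square_iff[symmetric])
      finally show ?thesis .
    qed
    define a where "a = p (slice_pt b y)"
    have pa: "p (slice_pt b y + h *\<^sub>R b) = a" for h
      using p_flat[of "slice_pt b y + h *\<^sub>R b"] by (simp add: flat_slice[OF b] a_def)
    have "\<bar>a\<bar> \<le> m" using p_le[of "slice_pt b y + 0 *\<^sub>R b"] True by (simp add: pa flat_slice[OF b] del: scaleR_zero_left)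
    have comp: "(slice_pt b y + h *\<^sub>R b) \<bullet> b = h" for h
      using nb by (simp add: inner_add_left slice_pt_inner[OF b])
    have f_eq: "f (slice_pt b y + h *\<^sub>R b)
      = (indicator (- A) h - indicator A h) * indicator {-l..l} h - t * (a * indicator {-1..1} h)" for h
      using True
      by (auto simp: f_def pa indicator_def A_def ball cyl_def comp flat_slice[OF b] N_def abs_le_iff)
    have s_int: "integrable lborel (\<lambda>h. (indicator (- A) h - indicator A h) * indicator {-l..l} h :: real)"
      by (rule integrable_bounded_support[where B = 1 and c = 0 and R = l])
         (auto simp: indicator_def dist_real_def)
    have "(\<integral>h. f (slice_pt b y + h *\<^sub>R b) \<partial>lborel)
      = (\<integral>h. (indicator (- A) h - indicator A h) * indicator {-l..l} h \<partial>lborel) - 2 * t * a"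
      unfolding f_eq by (subst Bochner_Integration.integral_diff) (auto intro!: s_int)
    moreover have "\<bar>(\<integral>h. (indicator (- A) h - indicator A h) * indicator {-l..l} h \<partial>lborel) - 2 * t * a\<bar>
        \<le> 2 * t * e + (if l < t * m then 2 * t * m else 0)"
    proof (rule interval_sign_integral[OF A l(1) t(1) e \<open>\<bar>a\<bar> \<le> m\<close>])
      show "h \<in> A" if "\<bar>h\<bar> \<le> l" "h + t * (a + e) < 0" for h
        using inF[of "slice_pt b y + h *\<^sub>R b"] that by (simp add: A_def ball pa comp)
      show "h + t * (a - e) \<le> 0" if "\<bar>h\<bar> \<le> l" "h \<in> A" for h
        using outF[of "slice_pt b y + h *\<^sub>R b"] that by (simp add: A_def ball pa comp)
    qed
    moreover have "N > \<rho>" if "l < t * m"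
    proof -
      have "l\<^sup>2 < (t * m)\<^sup>2" using that l by (intro power_strict_mono) auto
      then have "1 - (t * m)\<^sup>2 < N\<^sup>2" using l by simp
      then show ?thesis using N real_less_rsqrt real_sqrt_less_iff[of "1 - (t * m)\<^sup>2" "N\<^sup>2"]
        by (simp add: \<rho>_def)
    qed
    moreover have "g y = 2 * t * e + (if N > \<rho> then 2 * t * m else 0)"
      using True by (simp add: g_def N_def indicator_def algebra_simps)
    ultimately show ?thesis
      using tm by (auto simp: mult.assoc split: if_splits)
  qed
  have "(\<integral>z. ?s z \<partial>lborel) - t * (\<integral>z. ?c z \<partial>lborel) = (\<integral>z. f z \<partial>lborel)"
    unfolding f_def using int_s int_c by simp
  also have "\<dots> = (\<integral>y. (\<integral>h. f (slice_pt b y + h *\<^sub>R b) \<partial>lborel) \<partial>slice_measure b)"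
    by (rule slice_integral[OF b int_f])
  finally show ?thesis
    using integral_abs_le[OF g_int le] unfolding g_eq \<rho>_def by simp
qed

subsection \<open>Second moments of the tangential ball\<close>

text \<open>Orthogonality of \<open>w\<close> to \<open>b\<close> makes the reflection fix
  \<open>b\<close>; it therefore keeps heights and commutes with \<open>flat b\<close>.\<close>

lemma cyl_reflect:
  fixes b w :: "'a::real_inner"
  assumes "w \<bullet> b = 0"
  shows "reflect w z \<in> cyl b \<longleftrightarrow> z \<in> cyl b"
proof -
  have rb: "reflect w b = b" using assms by (simp add: reflect_def inner_commute)
  have "reflect w z \<bullet> b = z \<bullet> b" by (simp add: inner_reflect_left rb)
  moreover from this have "flat b (reflect w z) = reflect w (flat b z)"
    by (simp add: flat_def linear_diff[OF linear_reflect] linear_scale[OF linear_reflect] rb)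
  ultimately show ?thesis by (simp add: cyl_def)
qed

lemma integral_cyl_reflect:
  fixes b w :: "'a::euclidean_space"
  assumes "w \<bullet> b = 0" and [measurable]: "f \<in> borel_measurable borel"
  shows "(\<integral>z. f (reflect w z) * indicator (cyl b) z \<partial>lborel) = (\<integral>z. (f z :: real) * indicator (cyl b) z \<partial>lborel)"
proof -
  have "(\<integral>z. f z * indicator (cyl b) z \<partial>lborel) = (\<integral>z. f (reflect w z) * indicator (cyl b) (reflect w z) \<partial>lborel)"
    by (rule lborel_integral_reflect[symmetric]) measurable
  also have "\<dots> = (\<integral>z. f (reflect w z) * indicator (cyl b) z \<partial>lborel)"
    using cyl_reflect[OF assms(1)] by (simp add: indicator_def)
  finally show ?thesis by simp
qed

lemma integrable_cyl:
  fixes b :: "'a::euclidean_space" and f :: "'a \<Rightarrow> real"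
  assumes "norm b = 1" "continuous_on UNIV f"
  shows "integrable lborel (\<lambda>z. f z * indicator (cyl b) z)"
proof -
  have "compact (f ` cball 0 2)" using assms(2) by (intro compact_continuous_image continuous_on_subset[OF assms(2)]) auto
  then have "bounded (f ` cball 0 2)" by (rule compact_imp_bounded)
  then obtain B where B: "\<And>z. z \<in> cball 0 2 \<Longrightarrow> \<bar>f z\<bar> \<le> B"
    unfolding bounded_iff by (metis imageI real_norm_def)
  moreover have [measurable]: "f \<in> borel_measurable borel" using assms(2) by (rule borel_measurable_continuous_onI)
  ultimately show ?thesis
    using cyl_subset_cball[OF assms(1)]
    by (intro integrable_bounded_support[where B = B and c = 0 and R = 2])
      (auto simp: indicator_def subset_iff split: if_splits intro: order_trans[OF abs_ge_zero])
qed

text \<open>The reflection along \<open>i\<close> changes the sign of z . i, keeps z . j and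
  preserves the cylinder, so the integral equals its own negative.\<close>

lemma cyl_moment_off:
  fixes b i j :: "'a::euclidean_space"
  assumes "b \<in> Basis" "i \<in> Basis" "j \<in> Basis" "i \<noteq> b" "i \<noteq> j"
  shows "(\<integral>z. (z \<bullet> i) * (z \<bullet> j) * indicator (cyl b) z \<partial>lborel) = 0"
proof -
  have r: "reflect i i = - i" "reflect i j = j"
    using assms by (auto simp: reflect_def inner_Basis)
      (metis scaleR_2 add_diff_cancel_left' add.inverse_inverse diff_minus_eq_add minus_diff_eq)
  have "(\<integral>z. (reflect i z \<bullet> i) * (reflect i z \<bullet> j) * indicator (cyl b) z \<partial>lborel)
      = (\<integral>z. (z \<bullet> i) * (z \<bullet> j) * indicator (cyl b) z \<partial>lborel)"
    using assms by (intro integral_cyl_reflect) (auto simp: inner_Basis)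
  then show ?thesis by (simp add: inner_reflect_left r)
qed

text \<open>Sublevel sets of |y| are balls of known volume, so 1 - |y|^2 is written as the integral
  of 2 u over [|y|, 1]. With w the volume of the unit ball of the hyperplane, Tonelli leaves the
  integral of 2 u w u^(d-1) over [0, 1].\<close>

lemma slice_moment_one_minus_square:
  fixes b :: "'a::euclidean_space"
  assumes b: "b \<in> Basis" and d: "DIM('a) \<ge> 2"
  shows "(\<integral>y. (1 - (norm (slice_pt b y))\<^sup>2) * indicator {y. norm (slice_pt b y) \<le> 1} y \<partial>slice_measure b)
     = 2 * unit_ball_vol (real (DIM('a) - 1)) / (real DIM('a) + 1)" (is "integral\<^sup>L _ ?f = ?w")
proof -
  define k where "k = DIM('a) - 1"
  define w where "w = unit_ball_vol (real k)"
  have w: "w > 0" by (simp add: w_def)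
  interpret P: product_sigma_finite "\<lambda>_::'a. lborel :: real measure" by standard
  interpret P1: sigma_finite_measure "slice_measure b" by (rule P.sigma_finite) simp
  interpret pair_sigma_finite "slice_measure b" "lborel :: real measure" ..
  let ?n = "\<lambda>y. norm (slice_pt b y)"
  have "(\<integral>\<^sup>+y. ennreal (?f y) \<partial>slice_measure b)
     = (\<integral>\<^sup>+y. (\<integral>\<^sup>+u. ennreal (2 * u) * indicator {?n y..1} u \<partial>lborel) \<partial>slice_measure b)"
  proof (rule nn_integral_cong)
    fix y
    show "ennreal (?f y) = (\<integral>\<^sup>+u. ennreal (2 * u) * indicator {?n y..1} u \<partial>lborel)"
    proof (cases "?n y \<le> 1")
      case True
      have "(\<integral>\<^sup>+u. ennreal (2 * u) * indicator {?n y..1} u \<partial>lborel) = ennreal (1\<^sup>2 - (?n y)\<^sup>2)"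
        using True by (intro nn_integral_FTC_Icc)
          (auto intro!: derivative_eq_intros order_trans[OF norm_ge_zero])
      then show ?thesis using True by simp
    qed simp
  qed
  also have "\<dots> = (\<integral>\<^sup>+y. (\<integral>\<^sup>+u. ennreal (2 * u) * indicator {0..1} u * indicator {y. ?n y \<le> u} y \<partial>lborel) \<partial>slice_measure b)"
    by (intro nn_integral_cong) (auto simp: indicator_def order_trans[OF norm_ge_zero])
  also have "\<dots> = (\<integral>\<^sup>+u. (\<integral>\<^sup>+y. ennreal (2 * u) * indicator {0..1} u * indicator {y. ?n y \<le> u} y \<partial>slice_measure b) \<partial>lborel)"
    by (subst Fubini') (auto simp: indicator_def)
  also have "\<dots> = (\<integral>\<^sup>+u. ennreal (2 * w * u ^ Suc k) * indicator {0..1} u \<partial>lborel)"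
  proof (rule nn_integral_cong)
    fix u :: real
    show "(\<integral>\<^sup>+y. ennreal (2 * u) * indicator {0..1} u * indicator {y. ?n y \<le> u} y \<partial>slice_measure b)
       = ennreal (2 * w * u ^ Suc k) * indicator {0..1} u"
    proof (cases "u \<in> {0..1}")
      case True
      have "(\<integral>\<^sup>+y. ennreal (2 * u) * indicator {y. ?n y \<le> u} y \<partial>slice_measure b)
         = (\<integral>\<^sup>+y. ennreal (2 * u) * indicator {y \<in> space (slice_measure b). ?n y \<le> u} y \<partial>slice_measure b)"
        by (intro nn_integral_cong) (auto simp: indicator_def)
      also have "\<dots> = ennreal (2 * u) * ennreal (w * u ^ k)"
        using emeasure_slice_ball[OF b _ d, of u] True
        by (subst nn_integral_cmult_indicator) (auto simp: w_def k_def)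
      also have "\<dots> = ennreal (2 * w * u ^ Suc k)"
        using True w by (simp add: ennreal_mult'[symmetric] mult_ac)
      finally show ?thesis using True by simp
    qed simp
  qed
  also have "\<dots> = ennreal (2 * w / (k + 2) * 1 ^ Suc (Suc k) - 2 * w / (k + 2) * 0 ^ Suc (Suc k))"
  proof (rule nn_integral_FTC_Icc)
    fix u :: real
    have "((\<lambda>u. 2 * w / (k + 2) * u ^ Suc (Suc k)) has_real_derivative
        2 * w / (k + 2) * (real (Suc (Suc k)) * u ^ Suc k)) (at u)"
      using DERIV_cmult[OF DERIV_pow[of "Suc (Suc k)" u UNIV], of "2 * w / (k + 2)"] by simp
    also have "2 * w / (k + 2) * (real (Suc (Suc k)) * u ^ Suc k) = 2 * w * u ^ Suc k"
      by (simp add: field_simps)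
    finally show "((\<lambda>u. 2 * w / (k + 2) * u ^ Suc (Suc k)) has_real_derivative 2 * w * u ^ Suc k) (at u)" .
  qed (use w in auto)
  also have "\<dots> = ennreal ?w" using d by (simp add: w_def k_def of_nat_diff)
  finally have "(\<integral>\<^sup>+y. ennreal (?f y) \<partial>slice_measure b) = ennreal ?w" .
  then show ?thesis
    using w by (intro integral_eq_nn_integral[THEN trans])
      (auto simp: indicator_def power_le_one w_def k_def)
qed

text \<open>The reflection along j - i exchanges two tangential basis vectors, so the d - 1 diagonal
  moments agree. Their sum is the integral of |flat b z|^2, namely 2 w - 4 w/(d+1) = (d-1) 2
  w/(d+1), where the factor 2 is the height of the cylinder.\<close>

lemma cyl_moment_diag:
  fixes b i :: "'a::euclidean_space"
  assumes b: "b \<in> Basis" and d: "DIM('a) \<ge> 2" and i: "i \<in> Basis" "i \<noteq> b"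
  shows "(\<integral>z. (z \<bullet> i) * (z \<bullet> i) * indicator (cyl b) z \<partial>lborel)
     = 2 * unit_ball_vol (real (DIM('a) - 1)) / (real DIM('a) + 1)"
proof -
  define w where "w = unit_ball_vol (real (DIM('a) - 1))"
  have nb: "norm b = 1" "b \<bullet> b = 1" using b by (auto simp: inner_Basis)
  let ?I = "\<lambda>j. \<integral>z. (z \<bullet> j) * (z \<bullet> j) * indicator (cyl b) z \<partial>lborel"
  have swap: "?I j = ?I i" if "j \<in> Basis - {b}" for j
  proof -
    have r: "reflect (j - i) i = j"
      using that i reflect_swap[of j i] by (metis DiffD1 norm_Basis reflect_reflect)
    have "?I i = (\<integral>z. (reflect (j - i) z \<bullet> i) * (reflect (j - i) z \<bullet> i) * indicator (cyl b) z \<partial>lborel)"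
      using that b i by (intro integral_cyl_reflect[symmetric]) (auto simp: inner_diff_left inner_Basis)
    then show ?thesis by (simp add: inner_reflect_left r)
  qed
  have int: "integrable lborel (\<lambda>z. (1 - (norm (flat b z))\<^sup>2) * indicator (cyl b) z)"
    by (intro integrable_cyl nb) (auto simp: flat_def intro!: continuous_intros)
  have int1: "integrable lborel (\<lambda>z. 1 * indicator (cyl b) z :: real)"
    by (intro integrable_cyl nb) (auto intro!: continuous_intros)
  have sl: "indicator (cyl b) (slice_pt b y + h *\<^sub>R b)
     = (indicator {y. norm (slice_pt b y) \<le> 1} y * indicator {-1..1} h :: real)" for y h
    using nb by (auto simp: cyl_def indicator_def flat_slice[OF b] inner_add_left slice_pt_inner[OF b])
  have "(\<integral>z. (1 - (norm (flat b z))\<^sup>2) * indicator (cyl b) z \<partial>lborel)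
     = (\<integral>y. 2 * ((1 - (norm (slice_pt b y))\<^sup>2) * indicator {y. norm (slice_pt b y) \<le> 1} y) \<partial>slice_measure b)"
    unfolding slice_integral[OF b int] by (simp add: sl flat_slice[OF b] mult_ac)
  also have "\<dots> = 4 * w / (real DIM('a) + 1)"
    using slice_moment_one_minus_square[OF b d] by (simp add: w_def)
  finally have 1: "(\<integral>z. (1 - (norm (flat b z))\<^sup>2) * indicator (cyl b) z \<partial>lborel) = 4 * w / (real DIM('a) + 1)" .
  have "(\<integral>z. 1 * indicator (cyl b) z \<partial>lborel)
     = (\<integral>y. (2::real) * indicator {y. norm (slice_pt b y) \<le> 1} y \<partial>slice_measure b)"
    unfolding slice_integral[OF b int1] by (simp add: sl mult_ac)
  also have "\<dots> = 2 * w"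
    using integral_slice_ball(2)[OF b _ d, of 1] by (simp add: w_def)
  finally have 2: "(\<integral>z. 1 * indicator (cyl b) z \<partial>lborel) = 2 * w" .
  have sq: "(norm (flat b z))\<^sup>2 = (\<Sum>j\<in>Basis - {b}. (z \<bullet> j) * (z \<bullet> j))" for z
  proof -
    have "(norm z)\<^sup>2 = (\<Sum>j\<in>Basis. (z \<bullet> j) * (z \<bullet> j))"
      by (simp add: power2_norm_eq_inner euclidean_inner[of z z])
    also have "\<dots> = (z \<bullet> b)\<^sup>2 + (\<Sum>j\<in>Basis - {b}. (z \<bullet> j) * (z \<bullet> j))"
      using b by (simp add: sum.remove power2_eq_square)
    finally show ?thesis using norm_flat[OF nb(1), of z] by simp
  qed
  have intj: "integrable lborel (\<lambda>z. (z \<bullet> j) * (z \<bullet> j) * indicator (cyl b) z)" for j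
    by (intro integrable_cyl nb) (auto intro!: continuous_intros)
  have "real (DIM('a) - 1) * ?I i = (\<Sum>j\<in>Basis - {b}. ?I j)"
    using swap b by simp
  also have "\<dots> = (\<integral>z. (norm (flat b z))\<^sup>2 * indicator (cyl b) z \<partial>lborel)"
    unfolding sq sum_distrib_right using intj by (subst Bochner_Integration.integral_sum) auto
  also have "\<dots> = (\<integral>z. 1 * indicator (cyl b) z - (1 - (norm (flat b z))\<^sup>2) * indicator (cyl b) z \<partial>lborel)"
    by (intro Bochner_Integration.integral_cong) (auto simp: algebra_simps)
  also have "\<dots> = 2 * w - 4 * w / (real DIM('a) + 1)"
    using int int1 1 2 by (subst Bochner_Integration.integral_diff) auto
  also have "\<dots> = real (DIM('a) - 1) * (2 * w / (real DIM('a) + 1))"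
    using d by (simp add: field_simps of_nat_diff)
  finally show ?thesis using d unfolding w_def by (subst (asm) mult_cancel_left) auto
qed

subsection \<open>Volume imbalance of balls\<close>

text \<open>The function V of the overview, with the sign convention of
  \<open>Kcurv\<close>.\<close>

definition imbalance :: "'a::euclidean_space \<Rightarrow> 'a set \<Rightarrow> real \<Rightarrow> real"
  where "imbalance x S u = (\<integral>y. (indicator (- S) y - indicator S y) * indicator (cball x u) y \<partial>lborel)"

text \<open>The substitution y = x + u R z joins the dilation to the unit ball with a change of
  frame; the reflection R preserves both Lebesgue measure and the unit ball. The vector
  \<open>w\<close> stays free, to be chosen according to the normal.\<close>

lemma imbalance_rescale:
  fixes x w :: "'a::euclidean_space"
  assumes [measurable]: "S \<in> sets borel" and u: "u > 0"
  defines "F \<equiv> {z. x + u *\<^sub>R reflect w z \<in> S}"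
  shows "imbalance x S u
    = u ^ DIM('a) * (\<integral>z. (indicator (- F) z - indicator F z) * indicator (cball 0 1) z \<partial>lborel)"
proof -
  have [measurable]: "cball x u \<in> sets borel" by simp
  let ?g = "\<lambda>y. (indicator (- S) y - indicator S y) * indicator (cball x u) y :: real"
  have "imbalance x S u = u ^ DIM('a) * (\<integral>z. ?g (x + u *\<^sub>R z) \<partial>lborel)"
  proof -
    have [measurable]: "?g \<in> borel_measurable borel" by measurable
    have "imbalance x S u = (\<integral>y. ?g y \<partial>density (distr lborel borel (\<lambda>z. x + u *\<^sub>R z)) (\<lambda>_. ennreal (\<bar>u\<bar> ^ DIM('a))))"
      unfolding imbalance_def using u lborel_affine[of u x] by simp
    also have "\<dots> = (\<integral>y. \<bar>u\<bar> ^ DIM('a) *\<^sub>R ?g y \<partial>distr lborel borel (\<lambda>z. x + u *\<^sub>R z))"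
      by (rule integral_density) auto
    also have "\<dots> = (\<integral>z. \<bar>u\<bar> ^ DIM('a) *\<^sub>R ?g (x + u *\<^sub>R z) \<partial>lborel)"
      by (rule integral_distr) measurable
    also have "\<dots> = \<bar>u\<bar> ^ DIM('a) *\<^sub>R (\<integral>z. ?g (x + u *\<^sub>R z) \<partial>lborel)"
      by (rule integral_scaleR_right)
    finally show ?thesis using u by simp
  qed
  also have "(\<integral>z. ?g (x + u *\<^sub>R z) \<partial>lborel) = (\<integral>z. ?g (x + u *\<^sub>R reflect w z) \<partial>lborel)"
    by (rule lborel_integral_reflect[symmetric]) measurable
  also have "\<dots> = (\<integral>z. (indicator (- F) z - indicator F z) * indicator (cball 0 1) z \<partial>lborel)"
    using u by (intro Bochner_Integration.integral_cong) (auto simp: F_def indicator_def dist_norm)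
  finally show ?thesis .
qed

section \<open>Gradient and Hessian in a frame adapted to the normal\<close>

lemma inner_gradient_of: "blinfun_apply D z = gradient_of D \<bullet> z"
proof -
  have "blinfun_apply D z = blinfun_apply D (\<Sum>b\<in>Basis. (z \<bullet> b) *\<^sub>R b)"
    by (simp add: euclidean_representation)
  also have "\<dots> = gradient_of D \<bullet> z"
    unfolding gradient_of_def blinfun.sum_right inner_sum_left
    by (intro sum.cong refl) (simp add: blinfun.scaleR_right inner_commute)
  finally show ?thesis .
qed

text \<open>Orthogonal invariance of the trace, by expansion with c = 2/|w|^2: the two cross terms
  sum to -2 c Q(w,w), and the last term to c^2 |w|^2 Q(w,w) = 2 c Q(w,w).\<close>

lemma trace_reflect:
  fixes Q :: "'a::euclidean_space \<Rightarrow>\<^sub>L ('a \<Rightarrow>\<^sub>L real)"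
  shows "(\<Sum>i\<in>Basis. Q (reflect w i) (reflect w i)) = (\<Sum>i\<in>Basis. Q i i)"
proof (cases "w = 0")
  case False
  define c where "c = 2 / (w \<bullet> w)"
  have eq: "Q (reflect w i) (reflect w i)
     = Q i i - c * ((i \<bullet> w) * Q i w) - c * ((i \<bullet> w) * Q w i) + c\<^sup>2 * Q w w * ((w \<bullet> i) * (w \<bullet> i))" for i
  proof -
    define \<alpha> where "\<alpha> = c * (i \<bullet> w)"
    have r: "reflect w i = i - \<alpha> *\<^sub>R w" by (simp add: reflect_def c_def \<alpha>_def)
    have "Q (reflect w i) (reflect w i) = Q i i - \<alpha> * Q i w - \<alpha> * Q w i + \<alpha>\<^sup>2 * Q w w"
      unfolding r by (simp add: blinfun.diff_right blinfun.diff_left blinfun.scaleR_right blinfun.scaleR_left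
          algebra_simps power2_eq_square)
    then show ?thesis by (simp add: \<alpha>_def inner_commute[of w] power2_eq_square mult_ac)
  qed
  have 1: "(\<Sum>i\<in>Basis. (i \<bullet> w) * Q i w) = Q w w"
  proof -
    have "Q w w = Q (\<Sum>i\<in>Basis. (i \<bullet> w) *\<^sub>R i) w"
      by (simp add: euclidean_representation inner_commute[of _ w])
    then show ?thesis
      by (simp add: blinfun.sum_right blinfun.sum_left blinfun.scaleR_right blinfun.scaleR_left)
  qed
  have 2: "(\<Sum>i\<in>Basis. (i \<bullet> w) * Q w i) = Q w w"
  proof -
    have "Q w w = Q w (\<Sum>i\<in>Basis. (i \<bullet> w) *\<^sub>R i)"
      by (simp add: euclidean_representation inner_commute[of _ w])
    then show ?thesis by (simp add: blinfun.sum_right blinfun.scaleR_right)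
  qed
  have "(\<Sum>i\<in>Basis. Q (reflect w i) (reflect w i))
     = (\<Sum>i\<in>Basis. Q i i) - c * Q w w - c * Q w w + c\<^sup>2 * Q w w * (w \<bullet> w)"
    unfolding eq sum.distrib sum_subtractf sum_distrib_left[symmetric] 1 2 euclidean_inner[of w w, symmetric] ..
  also have "c\<^sup>2 * Q w w * (w \<bullet> w) = 2 * c * Q w w"
    using False by (simp add: c_def power2_eq_square)
  finally show ?thesis by simp
qed (simp add: reflect_def)

lemma abs_blinfun2_le:
  fixes Q :: "'a::real_normed_vector \<Rightarrow>\<^sub>L ('a \<Rightarrow>\<^sub>L real)"
  shows "\<bar>Q a c\<bar> \<le> norm Q * norm a * norm c"
proof -
  have "\<bar>Q a c\<bar> \<le> norm (Q a) * norm c" using norm_blinfun[of "Q a" c] by simp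
  also have "\<dots> \<le> norm Q * norm a * norm c"
    by (intro mult_right_mono norm_blinfun) simp
  finally show ?thesis .
qed

text \<open>In the reflected tangential basis the mixed moments vanish and the others share one
  value, so only the tangential trace survives. Once \<open>reflect w b\<close> is the unit normal,
  the last factor is the numerator of \<open>curv_formula\<close>.\<close>

lemma cyl_quadratic:
  fixes b w :: "'a::euclidean_space" and Q :: "'a \<Rightarrow>\<^sub>L ('a \<Rightarrow>\<^sub>L real)"
  assumes b: "b \<in> Basis" and d: "DIM('a) \<ge> 2"
  shows "(\<integral>z. Q (reflect w (flat b z)) (reflect w (flat b z)) * indicator (cyl b) z \<partial>lborel)
    = 2 * unit_ball_vol (real (DIM('a) - 1)) / (real DIM('a) + 1)
      * ((\<Sum>i\<in>Basis. Q i i) - Q (reflect w b) (reflect w b))"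
proof -
  let ?f = "reflect w" and ?B = "Basis - {b}"
  define c where "c = 2 * unit_ball_vol (real (DIM('a) - 1)) / (real DIM('a) + 1)"
  have nb: "norm b = 1" using b by simp
  have flat: "?f (flat b z) = (\<Sum>i\<in>?B. (z \<bullet> i) *\<^sub>R ?f i)" for z
  proof -
    have "z = (\<Sum>i\<in>Basis. (z \<bullet> i) *\<^sub>R i)" by (simp add: euclidean_representation)
    also have "\<dots> = (z \<bullet> b) *\<^sub>R b + (\<Sum>i\<in>?B. (z \<bullet> i) *\<^sub>R i)" using b by (simp add: sum.remove)
    finally have "flat b z = (\<Sum>i\<in>?B. (z \<bullet> i) *\<^sub>R i)" unfolding flat_def by (simp add: algebra_simps)
    then show ?thesis by (simp add: linear_sum[OF linear_reflect] linear_scale[OF linear_reflect])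
  qed
  have int: "integrable lborel (\<lambda>z. (z \<bullet> i) * (z \<bullet> j) * indicator (cyl b) z)" for i j
    by (intro integrable_cyl nb) (auto intro!: continuous_intros)
  have mom: "(\<integral>z. (z \<bullet> i) * (z \<bullet> j) * indicator (cyl b) z \<partial>lborel) = (if i = j then c else 0)"
    if "i \<in> ?B" "j \<in> ?B" for i j
    using that cyl_moment_off[OF b, of i j] cyl_moment_diag[OF b d, of i] by (auto simp: c_def)
  have expand: "Q (?f (flat b z)) (?f (flat b z)) * indicator (cyl b) z
    = (\<Sum>i\<in>?B. \<Sum>j\<in>?B. Q (?f j) (?f i) * ((z \<bullet> i) * (z \<bullet> j) * indicator (cyl b) z))" for z
  proof -
    have eq: "Q (?f (flat b z)) (?f (flat b z)) = (\<Sum>i\<in>?B. \<Sum>j\<in>?B. (z \<bullet> i) * ((z \<bullet> j) * Q (?f j) (?f i)))"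
      unfolding flat blinfun.sum_right blinfun.sum_left blinfun.scaleR_right blinfun.scaleR_left
        real_scaleR_def sum_distrib_left ..
    show ?thesis
      unfolding eq sum_distrib_right by (simp only: mult_ac)
  qed
  have "(\<integral>z. Q (?f (flat b z)) (?f (flat b z)) * indicator (cyl b) z \<partial>lborel)
     = (\<Sum>i\<in>?B. \<Sum>j\<in>?B. Q (?f j) (?f i) * (\<integral>z. (z \<bullet> i) * (z \<bullet> j) * indicator (cyl b) z \<partial>lborel))"
    unfolding expand
    by (subst Bochner_Integration.integral_sum,
        intro Bochner_Integration.integrable_sum integrable_mult_right int,
        subst Bochner_Integration.integral_sum, intro integrable_mult_right int, simp)
  also have "\<dots> = (\<Sum>i\<in>?B. \<Sum>j\<in>?B. if i = j then c * Q (?f i) (?f i) else 0)"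
    by (intro sum.cong refl) (auto simp: mom)
  also have "\<dots> = c * (\<Sum>i\<in>?B. Q (?f i) (?f i))" by (simp add: sum_distrib_left)
  also have "(\<Sum>i\<in>?B. Q (?f i) (?f i)) = (\<Sum>i\<in>Basis. Q i i) - Q (?f b) (?f b)"
    using b by (simp add: trace_reflect[symmetric, of Q w] sum.remove)
  finally show ?thesis by (simp add: c_def)
qed

text \<open>Combines sqrt (1 - a^2) \<ge> 1 - a with the Bernoulli inequality. With a = u m it
  bounds the relative volume of the clipping annulus by a multiple of u.\<close>

lemma one_minus_sqrt_power_le:
  fixes a :: real
  assumes "0 \<le> a" "a \<le> 1"
  shows "1 - sqrt (1 - a\<^sup>2) ^ k \<le> real k * a"
proof -
  have "a\<^sup>2 \<le> a" using assms by (simp add: power2_eq_square mult_left_le)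
  then have "1 - a \<le> sqrt (1 - a\<^sup>2)"
    using assms by (intro real_le_rsqrt) (auto simp: power2_eq_square algebra_simps)
  then have "(1 - a) ^ k \<le> sqrt (1 - a\<^sup>2) ^ k" using assms by (intro power_mono) auto
  moreover have "1 + real k * (- a) \<le> (1 + (- a)) ^ k" using assms by (intro Bernoulli_inequality) auto
  ultimately show ?thesis by simp
qed

text \<open>The constants are explicit in \<open>D\<close>, so that the linear part may vary with n.
  In the error, the \<eta> term is the band between the two barriers; of d + 3, the summand 3 pays
  for replacing the Hessian form by its tangential part and d for the clipping annulus.\<close>

lemma imbalance_estimate:
  fixes x :: "'a::euclidean_space" and D :: "'a \<Rightarrow>\<^sub>L real" and Q :: "'a \<Rightarrow>\<^sub>L ('a \<Rightarrow>\<^sub>L real)"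
  assumes d: "DIM('a) \<ge> 2" and S [measurable]: "S \<in> sets borel"
    and g: "gradient_of D \<noteq> 0" and \<eta>: "0 \<le> \<eta>" and u: "0 < u" "u \<le> \<delta>"
    and m: "norm Q / (2 * norm (gradient_of D)) + \<eta> / norm (gradient_of D) \<le> m" and um: "u * m \<le> 1"
    and inS: "\<And>z. norm z \<le> \<delta> \<Longrightarrow> D z + Q z z / 2 + \<eta> * (norm z)\<^sup>2 < 0 \<Longrightarrow> x + z \<in> S"
    and outS: "\<And>z. norm z \<le> \<delta> \<Longrightarrow> x + z \<in> S \<Longrightarrow> D z + Q z z / 2 - \<eta> * (norm z)\<^sup>2 \<le> 0"
  shows "\<bar>imbalance x S u - unit_ball_vol (real (DIM('a) - 1)) / (real DIM('a) + 1) * curv_formula D Q * u ^ (DIM('a) + 1)\<bar>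
    \<le> 2 * unit_ball_vol (real (DIM('a) - 1)) * (\<eta> / norm (gradient_of D) + (real DIM('a) + 3) * u * m\<^sup>2) * u ^ (DIM('a) + 1)"
proof -
  define \<omega> where "\<omega> = unit_ball_vol (real (DIM('a) - 1))"
  have \<omega>: "\<omega> > 0" by (simp add: \<omega>_def)
  define \<kappa> where "\<kappa> = norm (gradient_of D)"
  have \<kappa>: "\<kappa> > 0" using g by (simp add: \<kappa>_def)
  define \<nu> where "\<nu> = (1 / \<kappa>) *\<^sub>R gradient_of D"
  have n\<nu>: "norm \<nu> = 1" using \<kappa> by (simp add: \<nu>_def \<kappa>_def)
  obtain b :: 'a where b: "b \<in> Basis" using nonempty_Basis by blast
  have nb: "norm b = 1" "b \<bullet> b = 1" using b by (auto simp: inner_Basis)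
  \<comment> \<open>This reflection exchanges the unit normal and \<open>b\<close>, so in the new
    frame the linear part is \<kappa> times the height z . b.\<close>
  define f where "f = reflect (\<nu> - b)"
  have fb: "f b = \<nu>" "f \<nu> = b"
    using reflect_swap[of \<nu> b] n\<nu> nb reflect_reflect[of "\<nu> - b" \<nu>] by (auto simp: f_def)
  have lin: "linear f" by (simp add: f_def linear_reflect)
  have [measurable]: "f \<in> borel \<rightarrow>\<^sub>M borel" by (simp add: f_def)
  have nf: "norm (f z) = norm z" for z by (simp add: f_def)
  have Df: "D (f z) = \<kappa> * (z \<bullet> b)" for z
  proof -
    have "D (f z) = \<kappa> * (\<nu> \<bullet> f z)" using \<kappa> by (simp add: inner_gradient_of \<nu>_def)
    also have "\<nu> \<bullet> f z = f \<nu> \<bullet> z" by (simp add: f_def inner_reflect_left)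
    finally show ?thesis by (simp add: fb inner_commute)
  qed
  \<comment> \<open>\<open>q\<close> is the quadratic term divided by \<kappa>; its tangential part
    \<open>p\<close> is constant along \<open>b\<close>, as slicing requires.\<close>
  define q where "q z = Q (f z) (f z) / (2 * \<kappa>)" for z
  define p where "p z = q (flat b z)" for z
  define \<eta>' where "\<eta>' = \<eta> / \<kappa>"
  have \<eta>': "0 \<le> \<eta>'" using \<eta> \<kappa> by (simp add: \<eta>'_def)
  define nQ where "nQ = norm Q / (2 * \<kappa>)"
  have nQ: "0 \<le> nQ" "nQ + \<eta>' \<le> m" using m \<kappa> by (auto simp: nQ_def \<eta>'_def \<kappa>_def)
  have m0: "0 \<le> m" using nQ \<eta>' by simp
  have q_le: "\<bar>q z\<bar> \<le> nQ" if "norm z \<le> 1" for z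
  proof -
    have "\<bar>Q (f z) (f z)\<bar> \<le> norm Q * norm (f z) * norm (f z)" by (rule abs_blinfun2_le)
    also have "\<dots> \<le> norm Q * 1 * 1" using that by (intro mult_mono) (auto simp: nf)
    finally show ?thesis using \<kappa> by (simp add: q_def nQ_def divide_right_mono)
  qed
  have flat_le: "norm (flat b z) \<le> 1" "\<bar>z \<bullet> b\<bar> \<le> 1" if "norm z \<le> 1" for z
  proof -
    have "(norm z)\<^sup>2 \<le> 1" using that by (simp add: power_le_one)
    then have "(norm (flat b z))\<^sup>2 \<le> 1" "(z \<bullet> b)\<^sup>2 \<le> 1"
      using norm_flat[OF nb(1), of z] zero_le_power2[of "norm (flat b z)"] zero_le_power2[of "z \<bullet> b"] by linarith+
    then show "norm (flat b z) \<le> 1" "\<bar>z \<bullet> b\<bar> \<le> 1" by (auto simp: abs_square_le_1)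
  qed
  \<comment> \<open>After splitting into tangential and normal components, the two mixed terms and
    the purely normal term all contain the normal component, of length |z . b|: hence the 3.\<close>
  have qp: "\<bar>q z - p z\<bar> \<le> 3 * m * \<bar>z \<bullet> b\<bar>" if z: "norm z \<le> 1" for z
  proof -
    define a where "a = f (flat b z)"
    define c where "c = f ((z \<bullet> b) *\<^sub>R b)"
    have ac: "f z = a + c" unfolding a_def c_def linear_add[OF lin, symmetric] by (simp add: flat_def)
    have na: "norm a \<le> 1" using flat_le[OF z] by (simp add: a_def nf)
    have nc: "norm c = \<bar>z \<bullet> b\<bar>" "norm c \<le> 1" using flat_le[OF z] nb by (auto simp: c_def nf)
    have "Q (f z) (f z) - Q a a = Q a c + Q c a + Q c c"
      by (simp add: ac blinfun.add_right blinfun.add_left)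
    also have "\<bar>\<dots>\<bar> \<le> norm Q * norm a * norm c + norm Q * norm c * norm a + norm Q * norm c * norm c"
      using abs_blinfun2_le[of Q a c] abs_blinfun2_le[of Q c a] abs_blinfun2_le[of Q c c] by linarith
    also have "\<dots> = norm Q * norm c * (norm a + norm a + norm c)" by (simp add: algebra_simps)
    also have "\<dots> \<le> norm Q * norm c * 3" using na nc(2) by (intro mult_left_mono) auto
    finally have "\<bar>(Q (f z) (f z) - Q a a) / (2 * \<kappa>)\<bar> \<le> norm Q * norm c * 3 / (2 * \<kappa>)"
      using \<kappa> by (simp add: divide_right_mono)
    then have "\<bar>q z - p z\<bar> \<le> 3 * nQ * norm c"
      by (simp add: q_def p_def a_def nQ_def diff_divide_distrib mult_ac)
    also have "\<dots> \<le> 3 * m * norm c" using nQ \<eta>' by (intro mult_right_mono) auto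
    finally show ?thesis by (simp add: nc)
  qed
  \<comment> \<open>Only points with \<open>|z \<bullet> b| \<le> u m\<close> can violate the sign of \<open>z \<bullet> b\<close>; there \<open>q\<close> differs from its
    tangential part \<open>p\<close> by at most \<open>3 m (u m)\<close>, which is absorbed into \<open>e\<close>.\<close>
  define e where "e = \<eta>' + 3 * m * (u * m)"
  have e: "0 \<le> e" "\<eta>' \<le> e" using \<eta>' m0 u by (auto simp: e_def)
  define F where "F = {z. x + u *\<^sub>R f z \<in> S}"
  have [measurable]: "F \<in> sets borel" unfolding F_def by measurable
  \<comment> \<open>Division by u \<kappa> > 0 turns a barrier into the height plus \<open>u\<close>
    times a bounded term; c = \<eta> and c = -\<eta> give the two barriers.\<close>
  have scal: "D (u *\<^sub>R f z) + Q (u *\<^sub>R f z) (u *\<^sub>R f z) / 2 + c * (norm (u *\<^sub>R f z))\<^sup>2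
     = u * \<kappa> * (z \<bullet> b + u * (q z + c / \<kappa> * (norm z)\<^sup>2))" for z c
    using \<kappa> u by (simp add: blinfun.scaleR_right blinfun.scaleR_left Df q_def nf power_mult_distrib
      field_simps power2_eq_square)
  have ndelta: "norm (u *\<^sub>R f z) \<le> \<delta>" if "norm z \<le> 1" for z
    using that u order_trans[OF mult_left_le[of "norm z" u], of \<delta>] by (simp add: nf)
  have inF0: "z \<in> F" if z: "norm z \<le> 1" and neg: "z \<bullet> b + u * (q z + \<eta>') < 0" for z
  proof -
    have "(norm z)\<^sup>2 \<le> 1" using z by (simp add: power_le_one)
    then have "\<eta>' * (norm z)\<^sup>2 \<le> \<eta>'" using \<eta>' by (simp add: mult_left_le)
    then have "z \<bullet> b + u * (q z + \<eta>' * (norm z)\<^sup>2) \<le> z \<bullet> b + u * (q z + \<eta>')"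
      using u by (intro add_left_mono mult_left_mono) auto
    then have "z \<bullet> b + u * (q z + \<eta>' * (norm z)\<^sup>2) < 0" using neg by linarith
    then have "u * \<kappa> * (z \<bullet> b + u * (q z + \<eta>' * (norm z)\<^sup>2)) < 0"
      using u \<kappa> by (intro mult_pos_neg) auto
    then show ?thesis unfolding F_def using inS[OF ndelta[OF z]] scal[of z \<eta>] by (simp add: \<eta>'_def)
  qed
  have outF0: "z \<bullet> b + u * (q z - \<eta>') \<le> 0" if z: "norm z \<le> 1" and zF: "z \<in> F" for z
  proof -
    have "(norm z)\<^sup>2 \<le> 1" using z by (simp add: power_le_one)
    then have "\<eta>' * (norm z)\<^sup>2 \<le> \<eta>'" using \<eta>' by (simp add: mult_left_le)
    then have *: "z \<bullet> b + u * (q z - \<eta>') \<le> z \<bullet> b + u * (q z - \<eta>' * (norm z)\<^sup>2)"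
      using u by (intro add_left_mono mult_left_mono) auto
    have "u * \<kappa> * (z \<bullet> b + u * (q z - \<eta>' * (norm z)\<^sup>2)) \<le> 0"
      using outS[OF ndelta[OF z]] zF scal[of z "- \<eta>"] by (simp add: F_def \<eta>'_def)
    then have "z \<bullet> b + u * (q z - \<eta>' * (norm z)\<^sup>2) \<le> 0"
      using u \<kappa> by (simp add: mult_le_0_iff)
    then show ?thesis using * by linarith
  qed
  have p_le: "\<bar>p z\<bar> \<le> nQ" if "norm (flat b z) \<le> 1" for z
    using q_le[OF that] by (simp add: p_def)
  have inF: "z \<in> F" if z: "norm z \<le> 1" and neg: "z \<bullet> b + u * (p z + e) < 0" for z
  proof -
    have "u * (- nQ) \<le> u * (p z + e)"
      using p_le[OF flat_le(1)[OF z]] e u by (intro mult_left_mono) auto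
    then have lt: "z \<bullet> b < u * nQ" using neg by linarith
    also have "\<dots> \<le> u * m" using nQ \<eta>' u by (intro mult_left_mono) auto
    finally have lt: "z \<bullet> b < u * m" .
    have "z \<bullet> b + u * (q z + \<eta>') < 0"
    proof (cases "z \<bullet> b < - (u * m)")
      case True
      have "u * (q z + \<eta>') \<le> u * m" using q_le[OF z] nQ u by (intro mult_left_mono) auto
      then show ?thesis using True by linarith
    next
      case False
      then have "\<bar>z \<bullet> b\<bar> \<le> u * m" using lt by linarith
      then have "\<bar>q z - p z\<bar> \<le> 3 * m * (u * m)"
        using qp[OF z] m0 mult_left_mono[of "\<bar>z \<bullet> b\<bar>" "u * m" "3 * m"] by simp
      then have "u * (q z + \<eta>') \<le> u * (p z + e)" using u by (intro mult_left_mono) (auto simp: e_def)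
      then show ?thesis using neg by linarith
    qed
    then show ?thesis by (rule inF0[OF z])
  qed
  have outF: "z \<bullet> b + u * (p z - e) \<le> 0" if z: "norm z \<le> 1" and zF: "z \<in> F" for z
  proof (cases "z \<bullet> b < - (u * m)")
    case True
    have "u * (p z - e) \<le> u * m" using p_le[OF flat_le(1)[OF z]] nQ \<eta>' e u by (intro mult_left_mono) auto
    then show ?thesis using True by linarith
  next
    case False
    note 0 = outF0[OF z zF]
    have "u * (- m) \<le> u * (q z - \<eta>')" using q_le[OF z] nQ u by (intro mult_left_mono) auto
    then have "\<bar>z \<bullet> b\<bar> \<le> u * m" using False 0 by linarith
    then have "\<bar>q z - p z\<bar> \<le> 3 * m * (u * m)"
      using qp[OF z] m0 mult_left_mono[of "\<bar>z \<bullet> b\<bar>" "u * m" "3 * m"] by simp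
    then have "u * (p z - e) \<le> u * (q z - \<eta>')" using u by (intro mult_left_mono) (auto simp: e_def)
    then show ?thesis using 0 by linarith
  qed
  let ?I = "\<integral>z. (indicator (- F) z - indicator F z) * indicator (cball 0 1) z \<partial>lborel :: real"
  have "continuous_on UNIV f"
    using lin linear_continuous_on linear_conv_bounded_linear by blast
  then have "continuous_on UNIV (\<lambda>z. f (flat b z))"
    unfolding flat_def by (rule continuous_on_compose2) (auto intro!: continuous_intros)
  then have p_meas: "p \<in> borel_measurable borel"
    unfolding p_def q_def using \<kappa> by (intro borel_measurable_continuous_onI continuous_intros) auto
  have "\<bar>?I - u * (\<integral>z. p z * indicator (cyl b) z \<partial>lborel)\<bar>
      \<le> 2 * u * \<omega> * (e + m * (1 - sqrt (1 - (u * m)\<^sup>2) ^ (DIM('a) - 1)))"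
    unfolding \<omega>_def
  proof (rule cap_volume[OF b d])
    show "p (flat b z) = p z" for z using nb by (simp add: p_def flat_def inner_diff_left)
    show "\<bar>p z\<bar> \<le> m" if "norm (flat b z) \<le> 1" for z using p_le[OF that] nQ \<eta>' by simp
  qed (use u um e m0 inF outF p_meas in auto)
  also have "\<dots> \<le> 2 * u * \<omega> * (e + m * (real DIM('a) * (u * m)))"
  proof -
    have "1 - sqrt (1 - (u * m)\<^sup>2) ^ (DIM('a) - 1) \<le> real (DIM('a) - 1) * (u * m)"
      using u m0 um by (intro one_minus_sqrt_power_le) auto
    also have "\<dots> \<le> real DIM('a) * (u * m)" using u m0 by (intro mult_right_mono) auto
    finally show ?thesis using u \<omega> m0 by (intro mult_left_mono add_left_mono) auto
  qed
  also have "\<dots> = 2 * \<omega> * (\<eta>' + (real DIM('a) + 3) * u * m\<^sup>2) * u"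
    by (simp add: e_def algebra_simps power2_eq_square)
  \<comment> \<open>The Taylor factor 1/2 cancels the height 2 of the cylinder.\<close>
  also have "(\<integral>z. p z * indicator (cyl b) z \<partial>lborel) = \<omega> / (real DIM('a) + 1) * curv_formula D Q"
  proof -
    have "(\<integral>z. p z * indicator (cyl b) z \<partial>lborel)
       = (\<integral>z. Q (f (flat b z)) (f (flat b z)) * indicator (cyl b) z \<partial>lborel) / (2 * \<kappa>)"
      by (simp add: p_def q_def)
    also have "\<dots> = \<omega> / (real DIM('a) + 1) * (((\<Sum>i\<in>Basis. Q i i) - Q \<nu> \<nu>) / \<kappa>)"
      unfolding f_def cyl_quadratic[OF b d] fb(1)[unfolded f_def] \<omega>_def by simp
    finally show ?thesis by (simp add: curv_formula_def Let_def \<nu>_def \<kappa>_def)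
  qed
  finally have main: "\<bar>?I - u * (\<omega> / (real DIM('a) + 1) * curv_formula D Q)\<bar>
      \<le> 2 * \<omega> * (\<eta>' + (real DIM('a) + 3) * u * m\<^sup>2) * u" .
  have "imbalance x S u - \<omega> / (real DIM('a) + 1) * curv_formula D Q * u ^ (DIM('a) + 1)
     = u ^ DIM('a) * (?I - u * (\<omega> / (real DIM('a) + 1) * curv_formula D Q))"
    using imbalance_rescale[OF S u(1), of x "\<nu> - b"] unfolding F_def f_def by (simp add: algebra_simps)
  then have "\<bar>imbalance x S u - \<omega> / (real DIM('a) + 1) * curv_formula D Q * u ^ (DIM('a) + 1)\<bar>
     = u ^ DIM('a) * \<bar>?I - u * (\<omega> / (real DIM('a) + 1) * curv_formula D Q)\<bar>"
    using u by (simp add: abs_mult)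
  also have "\<dots> \<le> u ^ DIM('a) * (2 * \<omega> * (\<eta>' + (real DIM('a) + 3) * u * m\<^sup>2) * u)"
    using main u by (intro mult_left_mono) auto
  finally show ?thesis by (simp add: \<omega>_def \<eta>'_def \<kappa>_def mult_ac)
qed

subsection \<open>The layer cake formula for the nonlocal curvature\<close>

text \<open>Serves two exponents: d + s represents the kernel, and \<open>s\<close> measures tails
  after multiplication by the volume growth u^d.\<close>

lemma powr_tail_integral:
  fixes a q :: real
  assumes "a > 0" "q > 0"
  shows "has_bochner_integral lborel (\<lambda>u. q * u powr (- q - 1) * indicator {a..} u) (a powr (- q))"
proof (rule has_bochner_integral_nn_integral)
  have "(\<integral>\<^sup>+u. ennreal (q * u powr (- q - 1)) * indicator {a..} u \<partial>lborel) = 0 - (- (a powr (- q)))"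
  proof (rule nn_integral_FTC_atLeast)
    show "DERIV (\<lambda>u. - (u powr (- q))) u :> q * u powr (- q - 1)" if "a \<le> u" for u
      using that assms by (auto intro!: derivative_eq_intros)
    show "((\<lambda>u. - (u powr (- q))) \<longlongrightarrow> 0) at_top"
      using tendsto_minus[OF tendsto_neg_powr[of "- q", OF _ filterlim_ident]] assms(2) by simp
  qed (use assms in auto)
  then show "(\<integral>\<^sup>+u. ennreal (q * u powr (- q - 1) * indicator {a..} u) \<partial>lborel) = ennreal (a powr (- q))"
    by (simp add: ennreal_mult'' ennreal_indicator)
qed (use assms in auto)

lemma abs_imbalance_le:
  fixes x :: "'a::euclidean_space"
  assumes [measurable]: "S \<in> sets borel" and u: "0 \<le> u"
  shows "\<bar>imbalance x S u\<bar> \<le> unit_ball_vol (real DIM('a)) * u ^ DIM('a)"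
proof -
  have "\<bar>imbalance x S u\<bar> \<le> (\<integral>y. indicator (cball x u) y \<partial>lborel)"
    unfolding imbalance_def
  proof (rule integral_abs_le)
    show "integrable lborel (\<lambda>y. indicator (cball x u) y :: real)"
      by (rule integrable_real_indicator) (auto simp: emeasure_cball u)
  qed (auto simp: indicator_def)
  then show ?thesis by (simp add: content_cball u)
qed

text \<open>Truncation at \<open>r\<close> is the lower limit of integration: u \<ge> r and u \<ge>
  |x - y| together mean u \<ge> max r |x - y|, and \<open>kern\<close> is a power of this maximum.
  For Fubini, integrating absolute values over y leaves a multiple of u^(-s-1) on [r, \<infinity>),
  integrable because \<open>r\<close> and \<open>s\<close> are positive.\<close>

lemma Kcurv_layer_cake:
  fixes x :: "'a::euclidean_space"
  assumes [measurable]: "S \<in> sets borel" and r: "0 < r" and s: "0 < s"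
  defines "p \<equiv> real DIM('a) + s"
  shows "Kcurv s r x S = (\<integral>u. p * u powr (- p - 1) * indicator {r..} u * imbalance x S u \<partial>lborel)"
    and "integrable lborel (\<lambda>u. p * u powr (- p - 1) * indicator {r..} u * imbalance x S u)"
proof -
  have p: "p > 0" using s by (simp add: p_def add_nonneg_pos)
  define k where "k u = p * u powr (- p - 1) * indicator {r..} u" for u
  define \<sigma> where "\<sigma> y = indicator (- S) y - (indicator S y :: real)" for y
  have k0: "0 \<le> k u" for u using p by (simp add: k_def)
  have [measurable]: "k \<in> borel_measurable borel" "\<sigma> \<in> borel_measurable borel"
    unfolding k_def \<sigma>_def by measurable
  have \<sigma>: "\<bar>\<sigma> y\<bar> = 1" for y by (simp add: \<sigma>_def indicator_def)
  define f where "f u y = k u * (\<sigma> y * indicator {y. norm (x - y) \<le> u} y)" for u y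
  have f_meas: "case_prod f \<in> borel_measurable (lborel \<Otimes>\<^sub>M lborel)"
    unfolding f_def by measurable
  have ball: "{y. norm (x - y) \<le> u} = cball x u" for u by (auto simp: dist_norm)
  have int_ball: "integrable lborel (\<lambda>y. \<sigma> y * indicator (cball x u) y)" for u
    by (rule integrable_bounded_support[where B = 1 and c = x and R = u]) (auto simp: indicator_def \<sigma>)
  have imb: "(\<integral>y. f u y \<partial>lborel) = k u * imbalance x S u" for u
    by (simp add: f_def ball imbalance_def \<sigma>_def)
  have abs_f: "(\<integral>y. norm (f u y) \<partial>lborel)
     = p * unit_ball_vol (real DIM('a)) / s * (s * u powr (- s - 1) * indicator {r..} u)" for u
  proof (cases "r \<le> u")
    case True
    have "(\<integral>y. norm (f u y) \<partial>lborel) = (\<integral>y. k u * indicator (cball x u) y \<partial>lborel)"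
      using k0 by (intro Bochner_Integration.integral_cong) (auto simp: f_def abs_mult \<sigma> ball)
    also have "\<dots> = k u * (unit_ball_vol (real DIM('a)) * u ^ DIM('a))"
      using True r by (simp add: content_cball)
    also have "u ^ DIM('a) = u powr (real DIM('a))" using True r by (simp add: powr_realpow)
    also have "k u * (unit_ball_vol (real DIM('a)) * u powr (real DIM('a)))
      = p * unit_ball_vol (real DIM('a)) * (u powr (- p - 1) * u powr (real DIM('a)))"
      using True by (simp add: k_def)
    also have "u powr (- p - 1) * u powr (real DIM('a)) = u powr (- s - 1)"
      by (simp add: powr_add[symmetric] p_def)
    finally show ?thesis using True s by simp
  qed (simp add: f_def k_def)
  have int_f: "integrable (lborel \<Otimes>\<^sub>M lborel) (case_prod f)"
  proof (rule lborel_pair.Fubini_integrable)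
    show "integrable lborel (\<lambda>u. \<integral>y. norm (case (u, y) of (u, y) \<Rightarrow> f u y) \<partial>lborel)"
      unfolding prod.case abs_f
      using powr_tail_integral[OF r s] by (intro integrable_mult_right) (auto simp: has_bochner_integral_iff)
    show "AE u in lborel. integrable lborel (\<lambda>y. case (u, y) of (u, y) \<Rightarrow> f u y)"
      using int_ball by (simp add: f_def ball)
  qed (use f_meas in simp)
  show "integrable lborel (\<lambda>u. p * u powr (- p - 1) * indicator {r..} u * imbalance x S u)"
    using lborel_pair.integrable_fst'[OF int_f] unfolding imb by (simp add: k_def imb)
  have "(\<integral>u. f u y \<partial>lborel) = \<sigma> y * kern DIM('a) s r (norm (x - y))" for y
  proof -
    have "(\<integral>u. f u y \<partial>lborel) = (\<integral>u. \<sigma> y * (p * u powr (- p - 1) * indicator {max r (norm (x - y))..} u) \<partial>lborel)"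
      by (intro Bochner_Integration.integral_cong) (auto simp: f_def k_def indicator_def)
    also have "\<dots> = \<sigma> y * max r (norm (x - y)) powr (- p)"
      using powr_tail_integral[of "max r (norm (x - y))" p] r p
      by (simp add: has_bochner_integral_iff max.strict_coboundedI1)
    also have "max r (norm (x - y)) powr (- p) = kern DIM('a) s r (norm (x - y))"
      by (simp add: kern_def p_def max_def)
    finally show ?thesis .
  qed
  then have "Kcurv s r x S = (\<integral>y. (\<integral>u. f u y \<partial>lborel) \<partial>lborel)"
    by (simp add: Kcurv_def \<sigma>_def)
  also have "\<dots> = (\<integral>u. (\<integral>y. f u y \<partial>lborel) \<partial>lborel)" by (rule lborel_pair.Fubini_integral[OF int_f])
  finally show "Kcurv s r x S = (\<integral>u. p * u powr (- p - 1) * indicator {r..} u * imbalance x S u \<partial>lborel)"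
    by (simp add: imb k_def)
qed

text \<open>The weight p u^(-p-1) times c u^(d+1) is c p u^(-s), and \<open>J\<close> is the
  integral of p u^(-s) over [r, 1]. Above \<delta>, both V(u) and the comparison term cut off at 1
  are at most constants times u^d, so their contribution is controlled by the integral of u^(-s-1)
  over [\<delta>, \<infinity>), a bound free of \<open>r\<close>.\<close>

lemma Kcurv_estimate:
  fixes x :: "'a::euclidean_space"
  assumes S: "S \<in> sets borel" and r: "0 < r" "r < 1" and s: "1 < s" and \<delta>: "0 < \<delta>" "\<delta> \<le> 1" and \<epsilon>: "0 \<le> \<epsilon>"
    and imb: "\<And>u. 0 < u \<Longrightarrow> u \<le> \<delta> \<Longrightarrow> \<bar>imbalance x S u - c * u ^ (DIM('a) + 1)\<bar> \<le> \<epsilon> * u ^ (DIM('a) + 1)"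
  defines "J \<equiv> (real DIM('a) + 1) * beta DIM('a) r s - 1"
  shows "\<bar>Kcurv s r x S - c * J\<bar>
     \<le> \<epsilon> * J + (unit_ball_vol (real DIM('a)) + \<bar>c\<bar>) * (real DIM('a) + s) / s * \<delta> powr (- s)"
proof -
  define p where "p = real DIM('a) + s"
  define C where "C = unit_ball_vol (real DIM('a)) + \<bar>c\<bar>"
  have C: "0 \<le> C" by (simp add: C_def)
  have p: "p > 0" using s by (simp add: p_def add_nonneg_pos)
  have J: "J = p * (r powr (1 - s) - 1) / (s - 1)"
  proof -
    have "(real DIM('a) + 1) * beta DIM('a) r s
       = (real DIM('a) + 1) / (real DIM('a) + 1) * (p * ((r powr (1 - s) - 1) / (s - 1)) + 1)"
      unfolding beta_def p_def by (simp only: distrib_left times_divide_eq_left times_divide_eq_right mult_1_right mult_ac)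
    also have "(real DIM('a) + 1) / (real DIM('a) + 1) = 1" using DIM_positive by simp
    finally show ?thesis by (simp add: J_def)
  qed
  have hJ: "has_bochner_integral lborel (\<lambda>u. p * u powr (- s) * indicator {r..1} u) J"
  proof -
    have "has_bochner_integral lborel (\<lambda>u. p * u powr (- s) * indicator {r..1} u)
       (p * 1 powr (1 - s) / (1 - s) - p * r powr (1 - s) / (1 - s))"
    proof (rule has_bochner_integral_FTC_Icc_nonneg)
      show "DERIV (\<lambda>u. p * u powr (1 - s) / (1 - s)) u :> p * u powr (- s)" if "u \<in> {r..1}" for u
        using that r s by (auto intro!: derivative_eq_intros)
    qed (use r p in auto)
    also have "p * 1 powr (1 - s) / (1 - s) - p * r powr (1 - s) / (1 - s) = J"
      using s by (simp add: J divide_simps) (simp add: algebra_simps)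
    finally show ?thesis .
  qed
  have hT: "has_bochner_integral lborel (\<lambda>u. s * u powr (- s - 1) * indicator {\<delta>..} u) (\<delta> powr (- s))"
    using \<delta> s by (intro powr_tail_integral) auto
  let ?k = "\<lambda>u. p * u powr (- p - 1) * indicator {r..} u * imbalance x S u"
  let ?j = "\<lambda>u. p * u powr (- s) * indicator {r..1} u"
  let ?t = "\<lambda>u. s * u powr (- s - 1) * indicator {\<delta>..} u"
  have K: "Kcurv s r x S = (\<integral>u. ?k u \<partial>lborel)" "integrable lborel ?k"
    using Kcurv_layer_cake[OF S r(1), of s x] s by (simp_all add: p_def)
  have diff: "Kcurv s r x S - c * J = (\<integral>u. ?k u - c * ?j u \<partial>lborel)"
    using K hJ by (subst Bochner_Integration.integral_diff) (auto simp: has_bochner_integral_iff)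
  have le: "\<bar>\<integral>u. ?k u - c * ?j u \<partial>lborel\<bar> \<le> (\<integral>u. \<epsilon> * ?j u + C * p / s * ?t u \<partial>lborel)"
  proof (rule integral_abs_le)
    show "integrable lborel (\<lambda>u. \<epsilon> * ?j u + C * p / s * ?t u)"
      using hJ hT by (intro Bochner_Integration.integrable_add integrable_mult_right) (auto simp: has_bochner_integral_iff)
    fix u
    show "\<bar>?k u - c * ?j u\<bar> \<le> \<epsilon> * ?j u + C * p / s * ?t u"
    proof (cases "r \<le> u")
      case True
      then have u: "0 < u" using r by simp
      define v where "v = u powr (- p - 1)"
      have v: "0 \<le> v" by (simp add: v_def)
      have us: "u powr (- s) = v * u ^ (DIM('a) + 1)" "u powr (- s - 1) = v * u ^ DIM('a)"
        using u by (simp_all add: v_def powr_realpow[symmetric] powr_add[symmetric] p_def del: power_Suc power_add)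
      define i1 :: real where "i1 = indicator {r..1} u"
      define i2 :: real where "i2 = indicator {\<delta>..} u"
      have key: "\<bar>imbalance x S u - c * u ^ (DIM('a) + 1) * i1\<bar> \<le> \<epsilon> * u ^ (DIM('a) + 1) * i1 + C * u ^ DIM('a) * i2"
      proof -
        have imb': "\<bar>imbalance x S u\<bar> \<le> unit_ball_vol (real DIM('a)) * u ^ DIM('a)"
          using u S by (intro abs_imbalance_le) auto
        \<comment> \<open>On (\<delta>, 1] the comparison term is covered by u^(d+1) \<le> u^d;
          beyond 1 it is switched off by \<open>i1\<close>. The constant \<open>C\<close> is the
          unit ball volume plus |c| for this reason.\<close>
        consider "u \<le> \<delta>" | "\<delta> < u" "u \<le> 1" | "1 < u" by linarith
        then show ?thesis
        proof cases
          case 1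
          then have "i1 = 1" "0 \<le> C * u ^ DIM('a) * i2" using True \<delta> C u by (auto simp: i1_def i2_def)
          then show ?thesis using imb[OF u 1] by simp
        next
          case 2
          then have i: "i1 = 1" "i2 = 1" using True \<delta> by (auto simp: i1_def i2_def)
          have "\<bar>c * u ^ (DIM('a) + 1)\<bar> \<le> \<bar>c\<bar> * u ^ DIM('a)"
            using u 2 by (simp add: abs_mult mult_left_mono mult_left_le_one_le)
          moreover have "0 \<le> \<epsilon> * u ^ (DIM('a) + 1)" using \<epsilon> u by simp
          ultimately show ?thesis using imb' by (simp add: i C_def distrib_right)
        next
          case 3
          then have i: "i1 = 0" "i2 = 1" using \<delta> by (auto simp: i1_def i2_def)
          have "0 \<le> \<bar>c\<bar> * u ^ DIM('a)" using u by simp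
          then show ?thesis using imb' by (simp add: i C_def distrib_right)
        qed
      qed
      have "?k u - c * ?j u = p * v * (imbalance x S u - c * u ^ (DIM('a) + 1) * i1)"
        using True by (simp add: us v_def[symmetric] i1_def algebra_simps)
      then have "\<bar>?k u - c * ?j u\<bar> = p * v * \<bar>imbalance x S u - c * u ^ (DIM('a) + 1) * i1\<bar>"
        using p v by (simp add: abs_mult)
      also have "\<dots> \<le> p * v * (\<epsilon> * u ^ (DIM('a) + 1) * i1 + C * u ^ DIM('a) * i2)"
        using key p v by (intro mult_left_mono) auto
      also have "\<dots> = \<epsilon> * ?j u + C * p / s * ?t u"
        using s by (simp add: us i1_def i2_def algebra_simps)
      finally show ?thesis .
    qed (use \<epsilon> p s C in auto)
  qed
  have eq: "(\<integral>u. \<epsilon> * ?j u + C * p / s * ?t u \<partial>lborel) = \<epsilon> * J + C * p / s * \<delta> powr (- s)"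
  proof -
    have "(\<integral>u. \<epsilon> * ?j u + C * p / s * ?t u \<partial>lborel) = (\<integral>u. \<epsilon> * ?j u \<partial>lborel) + (\<integral>u. C * p / s * ?t u \<partial>lborel)"
      using integrable.intros[OF hJ] integrable.intros[OF hT]
      by (intro Bochner_Integration.integral_add integrable_mult_right)
    then show ?thesis
      unfolding integral_mult_right_zero has_bochner_integral_integral_eq[OF hJ]
        has_bochner_integral_integral_eq[OF hT] .
  qed
  show ?thesis using le unfolding diff[symmetric] eq unfolding C_def p_def .
qed

subsection \<open>Uniform second order expansion of the defining functions\<close>

lemma blinfun_apply_diff: "blinfun_apply (F - G) = (\<lambda>h. blinfun_apply F h - blinfun_apply G h)"
  by (auto simp: blinfun.diff_left)

text \<open>The base point \<open>a\<close> is free because it will be the preimage of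
  \<open>x\<close> under the n-th diffeomorphism, while the Hessian stays frozen at
  \<open>x\<close>. The ball is shrunk until the second derivative varies from its value at
  \<open>x\<close> by at most \<eta>.\<close>

lemma C2_taylor:
  fixes \<phi> :: "'a::euclidean_space \<Rightarrow> real"
  assumes \<rho>: "\<rho> > 0"
    and D: "\<And>y. y \<in> ball x \<rho> \<Longrightarrow> (\<phi> has_derivative blinfun_apply (D\<phi> y)) (at y)"
    and D2: "\<And>y. y \<in> ball x \<rho> \<Longrightarrow> (D\<phi> has_derivative blinfun_apply (D2\<phi> y)) (at y)"
    and cont: "continuous_on (ball x \<rho>) D2\<phi>" and \<eta>: "\<eta> > 0"
  obtains \<rho>' where "0 < \<rho>'" "\<rho>' \<le> \<rho>"
    "\<And>a v. a \<in> ball x \<rho>' \<Longrightarrow> a + v \<in> ball x \<rho>' \<Longrightarrow>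
       \<bar>\<phi> (a + v) - \<phi> a - D\<phi> a v - D2\<phi> x v v / 2\<bar> \<le> \<eta> * (norm v)\<^sup>2"
proof -
  define Q where "Q = D2\<phi> x"
  have "isCont D2\<phi> x" using cont \<rho> by (simp add: continuous_on_eq_continuous_at)
  then obtain e where e: "e > 0" "\<And>y. dist y x < e \<Longrightarrow> dist (D2\<phi> y) Q < \<eta>"
    unfolding continuous_at_eps_delta Q_def using \<eta> by blast
  define \<rho>' where "\<rho>' = min e \<rho>"
  have \<rho>': "0 < \<rho>'" "\<rho>' \<le> \<rho>" using e \<rho> by (auto simp: \<rho>'_def)
  have near: "norm (D2\<phi> y - Q) \<le> \<eta>" if "y \<in> ball x \<rho>'" for y
    using e(2)[of y] that by (simp add: \<rho>'_def dist_commute dist_norm norm_minus_commute)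
  have sub: "y \<in> ball x \<rho>" if "y \<in> ball x \<rho>'" for y using that by (simp add: \<rho>'_def)
  have grad: "norm (D\<phi> y - D\<phi> a - Q (y - a)) \<le> \<eta> * norm (y - a)"
    if "a \<in> ball x \<rho>'" "y \<in> ball x \<rho>'" for a y
  proof -
    have "norm ((D\<phi> y - Q y) - (D\<phi> a - Q a)) \<le> \<eta> * norm (y - a)"
    proof (rule differentiable_bound[of "ball x \<rho>'" _ "\<lambda>y. blinfun_apply (D2\<phi> y - Q)"])
      fix v assume v: "v \<in> ball x \<rho>'"
      have "((\<lambda>y. D\<phi> y - Q y) has_derivative (\<lambda>h. D2\<phi> v h - Q h)) (at v)"
        by (intro derivative_intros D2 sub v blinfun.bounded_linear_right bounded_linear_imp_has_derivative)
      then show "((\<lambda>y. D\<phi> y - Q y) has_derivative blinfun_apply (D2\<phi> v - Q)) (at v within ball x \<rho>')"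
        unfolding blinfun_apply_diff by (rule has_derivative_at_withinI)
      show "onorm (blinfun_apply (D2\<phi> v - Q)) \<le> \<eta>"
        using near[OF v] by (simp add: norm_blinfun.rep_eq)
    qed (use that in auto)
    then show ?thesis by (simp add: blinfun.diff_right algebra_simps)
  qed
  have "\<bar>\<phi> (a + v) - \<phi> a - D\<phi> a v - D2\<phi> x v v / 2\<bar> \<le> \<eta> * (norm v)\<^sup>2"
    if a: "a \<in> ball x \<rho>'" and av: "a + v \<in> ball x \<rho>'" for a v
  proof -
    \<comment> \<open>Working along the segment avoids the symmetry of the second derivative.\<close>
    define h where "h \<theta> = \<phi> (a + \<theta> *\<^sub>R v) - \<theta> * D\<phi> a v - \<theta>\<^sup>2 / 2 * Q v v" for \<theta> :: real
    define h' where "h' \<theta> = (D\<phi> (a + \<theta> *\<^sub>R v) - D\<phi> a - Q (\<theta> *\<^sub>R v)) v" for \<theta> :: real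
    have seg: "a + \<theta> *\<^sub>R v \<in> ball x \<rho>'" if "0 \<le> \<theta>" "\<theta> \<le> 1" for \<theta> :: real
    proof -
      have "(1 - \<theta>) *\<^sub>R a + \<theta> *\<^sub>R (a + v) \<in> ball x \<rho>'"
        using that a av by (intro convexD[OF convex_ball]) auto
      then show ?thesis by (simp add: algebra_simps)
    qed
    have der: "DERIV h \<theta> :> h' \<theta>" if "0 \<le> \<theta>" "\<theta> \<le> 1" for \<theta>
    proof -
      have "((\<lambda>\<theta>. \<phi> (a + \<theta> *\<^sub>R v)) has_derivative (\<lambda>k. D\<phi> (a + \<theta> *\<^sub>R v) (k *\<^sub>R v))) (at \<theta>)"
        using D[OF sub[OF seg[OF that]]]
        by (intro has_derivative_compose[where f = "\<lambda>\<theta>. a + \<theta> *\<^sub>R v" and g = \<phi>])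
          (auto intro!: derivative_eq_intros)
      then have "DERIV (\<lambda>\<theta>. \<phi> (a + \<theta> *\<^sub>R v)) \<theta> :> D\<phi> (a + \<theta> *\<^sub>R v) v"
        by (simp add: has_field_derivative_def blinfun.scaleR_right mult_commute_abs)
      then show ?thesis unfolding h_def h'_def
        by (auto intro!: derivative_eq_intros simp: blinfun.diff_left blinfun.scaleR_right blinfun.scaleR_left)
    qed
    obtain \<theta> where \<theta>: "0 < \<theta>" "\<theta> < 1" "h 1 - h 0 = (1 - 0) * h' \<theta>"
      using MVT2[of 0 1 h h'] der by auto
    have "\<bar>h' \<theta>\<bar> \<le> norm (D\<phi> (a + \<theta> *\<^sub>R v) - D\<phi> a - Q (\<theta> *\<^sub>R v)) * norm v"
      unfolding h'_def using norm_blinfun real_norm_def by metis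
    also have "\<dots> \<le> \<eta> * norm (\<theta> *\<^sub>R v) * norm v"
      using grad[OF a seg[of \<theta>]] \<theta> by (intro mult_right_mono) auto
    also have "\<dots> = \<theta> * (\<eta> * (norm v)\<^sup>2)" using \<theta> by (simp add: power2_eq_square)
    also have "\<dots> \<le> 1 * (\<eta> * (norm v)\<^sup>2)" using \<theta> \<eta> by (intro mult_right_mono) auto
    finally have "\<bar>h 1 - h 0\<bar> \<le> \<eta> * (norm v)\<^sup>2" using \<theta> by simp
    then show ?thesis by (simp add: h_def Q_def algebra_simps)
  qed
  with \<rho>' show thesis using that by blast
qed

text \<open>The bounds concern derivatives of \<Phi>, so the inverse is controlled through its
  increment v, for which \<Phi>(a + v) = x + z. As \<Phi> - id is \<epsilon>-Lipschitz with
  \<epsilon> \<le> 1/2, |v - z| \<le> \<epsilon> |v| and hence |v| \<le> 2 |z|. The constant 8 is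
  the bound 2 for \<open>B\<close> times the square of this factor 2.\<close>

lemma near_identity_inverse:
  fixes \<Phi> :: "'a::euclidean_space \<Rightarrow> 'a"
  assumes bij: "bij \<Phi>"
    and D: "\<And>y. (\<Phi> has_derivative blinfun_apply (D\<Phi> y)) (at y)"
    and D2: "\<And>y. (D\<Phi> has_derivative blinfun_apply (D2\<Phi> y)) (at y)"
    and B: "(inv \<Phi> has_derivative blinfun_apply B) (at x)"
    and \<epsilon>: "\<epsilon> \<le> 1/2"
    and close: "\<And>y. norm (D\<Phi> y - id_blinfun) \<le> \<epsilon>" "\<And>y. norm (D2\<Phi> y) \<le> \<epsilon>"
  shows "norm (B - id_blinfun) \<le> 2 * \<epsilon>"
    and "norm (inv \<Phi> (x + z) - inv \<Phi> x) \<le> 2 * norm z"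
    and "norm (inv \<Phi> (x + z) - inv \<Phi> x - z) \<le> 2 * \<epsilon> * norm z"
    and "norm (inv \<Phi> (x + z) - inv \<Phi> x - B z) \<le> 8 * \<epsilon> * (norm z)\<^sup>2"
proof -
  define a where "a = inv \<Phi> x"
  define A where "A = D\<Phi> a"
  have \<epsilon>0: "0 \<le> \<epsilon>" using close(2)[of 0] norm_ge_zero order_trans by blast
  have \<Phi>a: "\<Phi> a = x" using bij by (simp add: a_def bij_is_surj surj_f_inv_f)
  \<comment> \<open>The chain rule for both compositions makes \<open>B\<close> a two-sided inverse
    of \<open>A\<close>, so closeness of \<open>A\<close> to the identity passes to
    \<open>B\<close>.\<close>
  have AB: "A (B h) = h" and BA: "B (A h) = h" for h
  proof -
    have "((\<lambda>y. \<Phi> (inv \<Phi> y)) has_derivative (\<lambda>h. A (B h))) (at x)"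
      using has_derivative_compose[OF B, of \<Phi> "blinfun_apply A"] D[of a] by (simp add: A_def a_def)
    moreover have "(\<lambda>y. \<Phi> (inv \<Phi> y)) = (\<lambda>y. y)" using bij by (auto simp: bij_is_surj surj_f_inv_f)
    ultimately have "(\<lambda>h. A (B h)) = (\<lambda>h. h)"
      using has_derivative_unique[OF _ has_derivative_ident] by metis
    then show "A (B h) = h" by meson
    have "((\<lambda>y. inv \<Phi> (\<Phi> y)) has_derivative (\<lambda>h. B (A h))) (at a)"
      using has_derivative_compose[OF D[of a], of "inv \<Phi>" "blinfun_apply B"] B by (simp add: A_def \<Phi>a)
    moreover have "(\<lambda>y. inv \<Phi> (\<Phi> y)) = (\<lambda>y. y)" using bij by (auto simp: bij_is_inj)
    ultimately have "(\<lambda>h. B (A h)) = (\<lambda>h. h)"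
      using has_derivative_unique[OF _ has_derivative_ident] by metis
    then show "B (A h) = h" by meson
  qed
  have A_close: "norm (A h - h) \<le> \<epsilon> * norm h" for h
  proof -
    have "norm ((A - id_blinfun) h) \<le> norm (A - id_blinfun) * norm h" by (rule norm_blinfun)
    also have "\<dots> \<le> \<epsilon> * norm h" using close(1) by (intro mult_right_mono) (auto simp: A_def)
    finally show ?thesis by (simp add: blinfun.diff_left)
  qed
  have B_le: "norm (B h) \<le> 2 * norm h" for h
  proof -
    have "norm (B h) \<le> norm h + norm (A (B h) - B h)"
      using norm_triangle_sub[of "B h" h] by (simp add: AB norm_minus_commute)
    also have "\<dots> \<le> norm h + 1/2 * norm (B h)"
      using A_close[of "B h"] mult_right_mono[OF \<epsilon> norm_ge_zero[of "B h"]] by linarith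
    finally show ?thesis by simp
  qed
  show "norm (B - id_blinfun) \<le> 2 * \<epsilon>"
  proof (rule norm_blinfun_bound)
    fix h
    have "norm ((B - id_blinfun) h) = norm (A (B h) - B h)"
      by (simp add: blinfun.diff_left AB norm_minus_commute)
    also have "\<dots> \<le> \<epsilon> * norm (B h)" by (rule A_close)
    also have "\<dots> \<le> \<epsilon> * (2 * norm h)" using \<epsilon>0 by (intro mult_left_mono B_le)
    finally show "norm ((B - id_blinfun) h) \<le> 2 * \<epsilon> * norm h" by simp
  qed (use \<epsilon>0 in simp)
  define v where "v = inv \<Phi> (x + z) - a"
  have \<Phi>v: "\<Phi> (a + v) = x + z" using bij by (simp add: v_def bij_is_surj surj_f_inv_f)
  have vz: "norm (v - z) \<le> \<epsilon> * norm v"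
  proof -
    have "norm ((\<Phi> (a + v) - (a + v)) - (\<Phi> a - a)) \<le> \<epsilon> * norm (a + v - a)"
    proof (rule differentiable_bound[of UNIV _ "\<lambda>y. blinfun_apply (D\<Phi> y - id_blinfun)"])
      fix y
      have "((\<lambda>y. \<Phi> y - y) has_derivative (\<lambda>h. D\<Phi> y h - h)) (at y)"
        by (intro derivative_intros D)
      then show "((\<lambda>y. \<Phi> y - y) has_derivative blinfun_apply (D\<Phi> y - id_blinfun)) (at y within UNIV)"
        unfolding blinfun_apply_diff by simp
      show "onorm (blinfun_apply (D\<Phi> y - id_blinfun)) \<le> \<epsilon>"
        using close(1)[of y] by (simp add: norm_blinfun.rep_eq)
    qed auto
    then show ?thesis by (simp add: \<Phi>v \<Phi>a norm_minus_commute algebra_simps)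
  qed
  have vz2: "norm v \<le> 2 * norm z"
    using vz norm_triangle_sub[of v z] mult_right_mono[OF \<epsilon> norm_ge_zero[of v]] by simp
  show "norm (inv \<Phi> (x + z) - inv \<Phi> x) \<le> 2 * norm z"
    using vz2 by (simp add: v_def a_def)
  show "norm (inv \<Phi> (x + z) - inv \<Phi> x - z) \<le> 2 * \<epsilon> * norm z"
    using vz mult_left_mono[OF vz2 \<epsilon>0] by (simp add: v_def a_def)
  have DL: "norm (D\<Phi> y - A) \<le> \<epsilon> * norm (y - a)" for y
    unfolding A_def
  proof (rule differentiable_bound[of UNIV _ "\<lambda>y. blinfun_apply (D2\<Phi> y)"])
    show "onorm (blinfun_apply (D2\<Phi> y)) \<le> \<epsilon>" for y
      using close(2)[of y] by (simp add: norm_blinfun.rep_eq)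
  qed (use D2 in auto)
  \<comment> \<open>On this ball the derivative differs from \<open>A\<close> by at most \<epsilon>
    |v|, which makes the remainder quadratic in |v|.\<close>
  have "norm ((\<Phi> (a + v) - A (a + v)) - (\<Phi> a - A a)) \<le> \<epsilon> * norm v * norm (a + v - a)"
  proof (rule differentiable_bound[of "cball a (norm v)" _ "\<lambda>y. blinfun_apply (D\<Phi> y - A)"])
    fix y assume y: "y \<in> cball a (norm v)"
    have "((\<lambda>y. \<Phi> y - A y) has_derivative (\<lambda>h. D\<Phi> y h - A h)) (at y)"
      by (intro derivative_intros D blinfun.bounded_linear_right bounded_linear_imp_has_derivative)
    then show "((\<lambda>y. \<Phi> y - A y) has_derivative blinfun_apply (D\<Phi> y - A)) (at y within cball a (norm v))"
      unfolding blinfun_apply_diff by (rule has_derivative_at_withinI)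
    have "\<epsilon> * norm (y - a) \<le> \<epsilon> * norm v"
      using y \<epsilon>0 by (intro mult_left_mono) (auto simp: dist_norm norm_minus_commute)
    then show "onorm (blinfun_apply (D\<Phi> y - A)) \<le> \<epsilon> * norm v"
      using DL[of y] by (simp add: norm_blinfun.rep_eq)
  qed (auto simp: dist_norm)
  then have zA: "norm (z - A v) \<le> \<epsilon> * (norm v)\<^sup>2"
    by (simp add: \<Phi>v \<Phi>a blinfun.add_right power2_eq_square algebra_simps)
  have "v - B z = - (B (z - A v))" by (simp add: blinfun.diff_right BA)
  then have "norm (v - B z) \<le> 2 * norm (z - A v)" using B_le[of "z - A v"] by simp
  also have "\<dots> \<le> 2 * (\<epsilon> * (norm v)\<^sup>2)" using zA by simp
  also have "\<dots> \<le> 2 * (\<epsilon> * (2 * norm z)\<^sup>2)"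
    using vz2 \<epsilon>0 by (intro mult_left_mono power_mono) auto
  finally show "norm (inv \<Phi> (x + z) - inv \<Phi> x - B z) \<le> 8 * \<epsilon> * (norm z)\<^sup>2"
    by (simp add: v_def a_def power_mult_distrib)
qed


text \<open>\<open>L n\<close> is the derivative at \<open>x\<close> of \<phi> composed with the
  inverse of \<Phi>_n. The second derivative of this composition is never formed: \<phi> is expanded
  at the preimage a_n, and the increment v of the inverse is replaced by B_n z in the linear term
  and by z in the quadratic one, each at a cost of order \<epsilon> |z|^2.\<close>

lemma local_expansion:
  fixes x :: "'a::euclidean_space"
  assumes def: "local_defining E x \<rho> \<phi> D\<phi> D2\<phi>" and conv: "convC En E"
    and closed: "\<And>n. closed (En n)" and front: "\<And>n. x \<in> frontier (En n)"
  obtains L where "L \<longlonglongrightarrow> D\<phi> x"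
    "\<And>\<eta>. \<eta> > 0 \<Longrightarrow> \<exists>\<delta>>0. \<forall>\<^sub>F n in sequentially. \<forall>z. norm z \<le> \<delta> \<longrightarrow>
        (L n z + D2\<phi> x z z / 2 + \<eta> * (norm z)\<^sup>2 < 0 \<longrightarrow> x + z \<in> En n) \<and>
        (x + z \<in> En n \<longrightarrow> L n z + D2\<phi> x z z / 2 - \<eta> * (norm z)\<^sup>2 \<le> 0)"
proof -
  have \<rho>: "\<rho> > 0"
    and D: "\<And>y. y \<in> ball x \<rho> \<Longrightarrow> (\<phi> has_derivative blinfun_apply (D\<phi> y)) (at y)"
    and D2: "\<And>y. y \<in> ball x \<rho> \<Longrightarrow> (D\<phi> has_derivative blinfun_apply (D2\<phi> y)) (at y)"
    and cont: "continuous_on (ball x \<rho>) D2\<phi>"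
    and E: "E \<inter> ball x \<rho> = {y \<in> ball x \<rho>. \<phi> y \<le> 0}"
    using def by (auto simp: local_defining_def)
  from conv obtain \<Phi> D\<Phi> D2\<Phi> where
    diffeo: "\<forall>n. bij (\<Phi> n) \<and> C2_on UNIV (inv (\<Phi> n))
             \<and> (\<forall>y. (\<Phi> n has_derivative blinfun_apply (D\<Phi> n y)) (at y)
                  \<and> (D\<Phi> n has_derivative blinfun_apply (D2\<Phi> n y)) (at y))
             \<and> continuous_on UNIV (D2\<Phi> n) \<and> \<Phi> n ` E = En n"
    and near_id: "\<forall>\<epsilon>>0. \<forall>\<^sub>F n in sequentially. \<forall>y.
            norm (\<Phi> n y - y) \<le> \<epsilon> \<and> norm (D\<Phi> n y - id_blinfun) \<le> \<epsilon> \<and> norm (D2\<Phi> n y) \<le> \<epsilon>"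
    unfolding convC_def by (elim exE conjE)
  have bij: "bij (\<Phi> n)" and C2i: "C2_on UNIV (inv (\<Phi> n))" and im: "\<Phi> n ` E = En n"
    and \<Phi>: "(\<Phi> n has_derivative blinfun_apply (D\<Phi> n y)) (at y)"
    and \<Phi>2: "(D\<Phi> n has_derivative blinfun_apply (D2\<Phi> n y)) (at y)" for n y
    using diffeo by simp_all
  have close: "\<forall>\<^sub>F n in sequentially. \<forall>y.
            norm (\<Phi> n y - y) \<le> \<epsilon> \<and> norm (D\<Phi> n y - id_blinfun) \<le> \<epsilon> \<and> norm (D2\<Phi> n y) \<le> \<epsilon>"
    if "\<epsilon> > 0" for \<epsilon>
    using near_id that by simp
  have "\<exists>B. (inv (\<Phi> n) has_derivative blinfun_apply B) (at x)" for n
    using C2i[of n] unfolding C2_on_def by blast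
  then obtain B where B: "\<And>n. (inv (\<Phi> n) has_derivative blinfun_apply (B n)) (at x)" by metis
  define a where "a n = inv (\<Phi> n) x" for n
  define L where "L n = D\<phi> (a n) o\<^sub>L B n" for n
  have mem: "y \<in> En n \<longleftrightarrow> inv (\<Phi> n) y \<in> E" for n y
  proof
    assume "y \<in> En n"
    then obtain w where "w \<in> E" "y = \<Phi> n w" using im[of n] by auto
    then show "inv (\<Phi> n) y \<in> E" using inv_f_f[OF bij_is_inj[OF bij[of n]]] by simp
  next
    assume "inv (\<Phi> n) y \<in> E"
    then have "\<Phi> n (inv (\<Phi> n) y) \<in> En n" using im[of n] by auto
    then show "y \<in> En n" using surj_f_inv_f[OF bij_is_surj[OF bij[of n]]] by simp
  qed
  have a_lim: "a \<longlonglongrightarrow> x"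
  proof (rule tendstoI)
    fix e :: real assume "e > 0"
    then have "e / 2 > 0" by simp
    from close[OF this] show "\<forall>\<^sub>F n in sequentially. dist (a n) x < e"
    proof eventually_elim
      case (elim n)
      then have "norm (\<Phi> n (a n) - a n) \<le> e / 2" by blast
      moreover have "\<Phi> n (a n) = x" using surj_f_inv_f[OF bij_is_surj[OF bij[of n]]] by (simp add: a_def)
      ultimately have "dist (a n) x \<le> e / 2" by (simp add: dist_norm norm_minus_commute)
      then show "dist (a n) x < e" using \<open>e > 0\<close> by linarith
    qed
  qed
  have B_lim: "B \<longlonglongrightarrow> id_blinfun"
  proof (rule tendstoI)
    fix e :: real assume "e > 0"
    define \<epsilon> where "\<epsilon> = min (1/2) (e/3)"
    have \<epsilon>: "\<epsilon> > 0" "\<epsilon> \<le> 1/2" "2 * \<epsilon> < e" using \<open>e > 0\<close> by (auto simp: \<epsilon>_def min_def)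
    show "\<forall>\<^sub>F n in sequentially. dist (B n) id_blinfun < e"
      using close[OF \<epsilon>(1)]
    proof eventually_elim
      case (elim n)
      have "norm (B n - id_blinfun) \<le> 2 * \<epsilon>"
        using elim by (intro near_identity_inverse(1)[OF bij \<Phi> \<Phi>2 B \<epsilon>(2)]) auto
      then show ?case using \<epsilon> by (simp add: dist_norm)
    qed
  qed
  have "isCont D\<phi> x" using D2[of x] \<rho> by (intro has_derivative_continuous) auto
  then have D\<phi>_lim: "(\<lambda>n. D\<phi> (a n)) \<longlonglongrightarrow> D\<phi> x" using a_lim by (rule isCont_tendsto_compose)
  have L_lim: "L \<longlonglongrightarrow> D\<phi> x"
  proof -
    have "D\<phi> x o\<^sub>L id_blinfun = D\<phi> x" by (rule blinfun_eqI) simp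
    then show ?thesis
      using bounded_bilinear.tendsto[OF bounded_bilinear_blinfun_compose D\<phi>_lim B_lim]
      unfolding L_def by simp
  qed
  \<comment> \<open>This removes the constant term of the expansion. If \<phi> were negative at a_n,
    continuity would put a neighbourhood of \<open>x\<close> inside \<open>En n\<close>, although
    \<open>x\<close> is a frontier point.\<close>
  have zero: "\<phi> (a n) = 0" if an: "a n \<in> ball x \<rho>" for n
  proof (rule antisym)
    have "x \<in> En n" using front[of n] closed[of n] by (simp add: frontier_def)
    then have "a n \<in> E" by (simp add: mem a_def)
    then show "\<phi> (a n) \<le> 0" using E an by blast
    show "0 \<le> \<phi> (a n)"
    proof (rule ccontr)
      assume neg: "\<not> 0 \<le> \<phi> (a n)"
      have "isCont \<phi> (a n)" using D[OF an] by (rule has_derivative_continuous)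
      moreover have "isCont (inv (\<Phi> n)) x" using B by (rule has_derivative_continuous)
      ultimately have "isCont (\<lambda>y. \<phi> (inv (\<Phi> n) y)) x" unfolding a_def by (rule isCont_o2[rotated])
      then have "((\<lambda>y. \<phi> (inv (\<Phi> n) y)) \<longlongrightarrow> \<phi> (a n)) (nhds x)"
        using tendsto_at_iff_tendsto_nhds[of "\<lambda>y. \<phi> (inv (\<Phi> n) y)" x] by (simp add: isCont_def a_def)
      then have "\<forall>\<^sub>F y in nhds x. \<phi> (inv (\<Phi> n) y) < 0"
        using neg by (intro order_tendstoD(2)) auto
      moreover have "(inv (\<Phi> n) \<longlongrightarrow> a n) (nhds x)"
        using \<open>isCont (inv (\<Phi> n)) x\<close> tendsto_at_iff_tendsto_nhds[of "inv (\<Phi> n)" x] by (simp add: isCont_def a_def)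
      then have "\<forall>\<^sub>F y in nhds x. inv (\<Phi> n) y \<in> ball x \<rho>"
        using an by (intro topological_tendstoD) auto
      ultimately have "\<forall>\<^sub>F y in nhds x. y \<in> En n"
      proof eventually_elim
        case (elim y)
        then show ?case using E mem by fastforce
      qed
      then have "x \<in> interior (En n)" by (auto simp: eventually_nhds interior_def)
      then show False using front[of n] by (simp add: frontier_def)
    qed
  qed
  have main: "\<exists>\<delta>>0. \<forall>\<^sub>F n in sequentially. \<forall>z. norm z \<le> \<delta> \<longrightarrow>
        (L n z + D2\<phi> x z z / 2 + \<eta> * (norm z)\<^sup>2 < 0 \<longrightarrow> x + z \<in> En n) \<and>
        (x + z \<in> En n \<longrightarrow> L n z + D2\<phi> x z z / 2 - \<eta> * (norm z)\<^sup>2 \<le> 0)" if \<eta>: "\<eta> > 0" for \<eta>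
  proof -
    define Q where "Q = D2\<phi> x"
    define M where "M = norm (D\<phi> x) + 1"
    \<comment> \<open>8 M is the error factor of the linear term; 3 |Q| is half of the factor 6 |Q|
      for the quadratic form, which enters with coefficient 1/2.\<close>
    define C where "C = 8 * M + 3 * norm Q + 1"
    have M: "M > 0" using norm_ge_zero[of "D\<phi> x"] unfolding M_def by linarith
    then have C: "C > 0" using norm_ge_zero[of Q] unfolding C_def by linarith
    \<comment> \<open>Since |v| \<le> 2 |z|, the Taylor error with \<eta>/8 becomes \<eta>/2 in
      terms of z; the other half of \<eta> pays for replacing v.\<close>
    obtain \<rho>' where \<rho>': "0 < \<rho>'" "\<rho>' \<le> \<rho>" and taylor: "\<And>a v. a \<in> ball x \<rho>' \<Longrightarrow> a + v \<in> ball x \<rho>' \<Longrightarrow>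
       \<bar>\<phi> (a + v) - \<phi> a - D\<phi> a v - Q v v / 2\<bar> \<le> \<eta> / 8 * (norm v)\<^sup>2"
      using C2_taylor[OF \<rho> D D2 cont, of "\<eta> / 8"] \<eta> unfolding Q_def by (metis divide_pos_pos zero_less_numeral)
    define \<epsilon> where "\<epsilon> = min (1/2) (\<eta> / (2 * C))"
    have \<epsilon>: "\<epsilon> > 0" "\<epsilon> \<le> 1/2" using \<eta> M C by (auto simp: \<epsilon>_def)
    have "\<epsilon> \<le> \<eta> / (2 * C)" by (simp add: \<epsilon>_def)
    then have \<epsilon>C: "C * \<epsilon> \<le> \<eta> / 2" using M C by (simp add: field_simps)
    \<comment> \<open>Then |v| \<le> 2 \<delta> = \<rho>'/4, which with |a_n - x| < \<rho>'/2 keeps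
      a_n + v in the ball of the Taylor estimate.\<close>
    define \<delta> where "\<delta> = \<rho>' / 8"
    have \<delta>: "\<delta> > 0" using \<rho>' by (simp add: \<delta>_def)
    have ev_a: "\<forall>\<^sub>F n in sequentially. dist (a n) x < \<rho>' / 2" using tendstoD[OF a_lim, of "\<rho>' / 2"] \<rho>' by simp
    have ev_D: "\<forall>\<^sub>F n in sequentially. norm (D\<phi> (a n)) < M"
      using order_tendstoD(2)[OF tendsto_norm[OF D\<phi>_lim], of M] by (simp add: M_def)
    show ?thesis
    proof (intro exI[of _ \<delta>] conjI \<delta>)
      show "\<forall>\<^sub>F n in sequentially. \<forall>z. norm z \<le> \<delta> \<longrightarrow>
        (L n z + D2\<phi> x z z / 2 + \<eta> * (norm z)\<^sup>2 < 0 \<longrightarrow> x + z \<in> En n) \<and>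
        (x + z \<in> En n \<longrightarrow> L n z + D2\<phi> x z z / 2 - \<eta> * (norm z)\<^sup>2 \<le> 0)"
        using close[OF \<epsilon>(1)] ev_a ev_D
      proof (eventually_elim, intro allI impI)
        fix n and z :: 'a
        assume cl: "\<forall>y. norm (\<Phi> n y - y) \<le> \<epsilon> \<and> norm (D\<Phi> n y - id_blinfun) \<le> \<epsilon> \<and> norm (D2\<Phi> n y) \<le> \<epsilon>"
          and an: "dist (a n) x < \<rho>' / 2" and Dn: "norm (D\<phi> (a n)) < M" and z: "norm z \<le> \<delta>"
        note inv = near_identity_inverse(2-4)[OF bij \<Phi> \<Phi>2 B \<epsilon>(2), of n z]
        define v where "v = inv (\<Phi> n) (x + z) - a n"
        have v: "norm v \<le> 2 * norm z" "norm (v - z) \<le> 2 * \<epsilon> * norm z" "norm (v - B n z) \<le> 8 * \<epsilon> * (norm z)\<^sup>2"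
          using inv cl by (auto simp: v_def a_def)
        have an_ball: "a n \<in> ball x \<rho>'" using an \<rho>' by (simp add: dist_commute)
        have "dist x (a n + v) \<le> dist x (a n) + norm v"
          by (metis dist_norm dist_triangle2 dist_commute add_diff_cancel_left')
        then have av_ball: "a n + v \<in> ball x \<rho>'" using v(1) z an \<rho>' by (simp add: \<delta>_def dist_commute)
        have \<phi>0: "\<phi> (a n) = 0" using an_ball \<rho>' by (intro zero) auto
        have t1: "\<bar>\<phi> (a n + v) - D\<phi> (a n) v - Q v v / 2\<bar> \<le> \<eta> / 2 * (norm z)\<^sup>2"
        proof -
          have "(norm v)\<^sup>2 \<le> (2 * norm z)\<^sup>2" using v(1) by (intro power_mono) auto
          then have "\<eta> / 8 * (norm v)\<^sup>2 \<le> \<eta> / 8 * (2 * norm z)\<^sup>2" using \<eta> by (intro mult_left_mono) auto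
          then show ?thesis using taylor[OF an_ball av_ball] by (simp add: \<phi>0 power_mult_distrib)
        qed
        have t2: "\<bar>D\<phi> (a n) v - L n z\<bar> \<le> 8 * M * \<epsilon> * (norm z)\<^sup>2"
        proof -
          have "\<bar>D\<phi> (a n) v - L n z\<bar> = norm (D\<phi> (a n) (v - B n z))"
            by (simp add: L_def blinfun.diff_right)
          also have "\<dots> \<le> norm (D\<phi> (a n)) * norm (v - B n z)" by (rule norm_blinfun)
          also have "\<dots> \<le> M * (8 * \<epsilon> * (norm z)\<^sup>2)" using Dn v M C by (intro mult_mono) auto
          finally show ?thesis by (simp add: mult_ac)
        qed
        have t3: "\<bar>Q v v - Q z z\<bar> \<le> 6 * norm Q * \<epsilon> * (norm z)\<^sup>2"
        proof -
          have "Q v v - Q z z = Q (v - z) v + Q z (v - z)"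
            by (simp add: blinfun.diff_right blinfun.diff_left)
          also have "\<bar>\<dots>\<bar> \<le> norm Q * norm (v - z) * norm v + norm Q * norm z * norm (v - z)"
            using abs_blinfun2_le[of Q "v - z" v] abs_blinfun2_le[of Q z "v - z"] by linarith
          also have "\<dots> = norm Q * norm (v - z) * (norm v + norm z)" by (simp add: algebra_simps)
          also have "\<dots> \<le> norm Q * (2 * \<epsilon> * norm z) * (3 * norm z)"
            using v \<epsilon> by (intro mult_mono) auto
          finally show ?thesis by (simp add: power2_eq_square mult_ac)
        qed
        have "(8 * M + 3 * norm Q) * \<epsilon> \<le> \<eta> / 2" using \<epsilon>C \<epsilon> by (simp add: C_def distrib_right)
        then have "(8 * M + 3 * norm Q) * \<epsilon> * (norm z)\<^sup>2 \<le> \<eta> / 2 * (norm z)\<^sup>2" by (intro mult_right_mono) auto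
        then have "8 * M * \<epsilon> * (norm z)\<^sup>2 + 3 * norm Q * \<epsilon> * (norm z)\<^sup>2 \<le> \<eta> / 2 * (norm z)\<^sup>2"
          by (simp add: distrib_right)
        then have fin: "\<bar>\<phi> (a n + v) - (L n z + Q z z / 2)\<bar> \<le> \<eta> * (norm z)\<^sup>2"
          using t1 t2 t3 by linarith
        have "a n + v \<in> ball x \<rho>" using av_ball \<rho>' by auto
        then have "a n + v \<in> E \<longleftrightarrow> \<phi> (a n + v) \<le> 0" using E by blast
        moreover have "x + z \<in> En n \<longleftrightarrow> a n + v \<in> E" unfolding mem v_def by simp
        ultimately show "(L n z + D2\<phi> x z z / 2 + \<eta> * (norm z)\<^sup>2 < 0 \<longrightarrow> x + z \<in> En n) \<and>
          (x + z \<in> En n \<longrightarrow> L n z + D2\<phi> x z z / 2 - \<eta> * (norm z)\<^sup>2 \<le> 0)"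
          using fin unfolding Q_def[symmetric] abs_le_iff by linarith
      qed
    qed
  qed
  show thesis using that[OF L_lim main] .
qed

subsection \<open>Convergence\<close>

lemma tendsto_gradient_of:
  assumes "(L \<longlongrightarrow> D) F" shows "((\<lambda>n. gradient_of (L n)) \<longlongrightarrow> gradient_of D) F"
  unfolding gradient_of_def using assms
  by (intro tendsto_sum tendsto_scaleR tendsto_const blinfun.tendsto)

lemma gradient_of_eq_0_iff: "gradient_of D = 0 \<longleftrightarrow> D = 0"
proof
  assume "gradient_of D = 0"
  then show "D = 0" by (intro blinfun_eqI) (simp add: inner_gradient_of[of D])
qed (simp add: gradient_of_def)

lemma tendsto_curv_formula:
  fixes L :: "nat \<Rightarrow> 'a::euclidean_space \<Rightarrow>\<^sub>L real"
  assumes "L \<longlonglongrightarrow> D" "D \<noteq> 0"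
  shows "(\<lambda>n. curv_formula (L n) Q) \<longlonglongrightarrow> curv_formula D Q"
  unfolding curv_formula_def Let_def using assms
  by (intro tendsto_intros blinfun.tendsto tendsto_gradient_of) (auto simp: gradient_of_eq_0_iff)

text \<open>The radius \<delta> precedes n: one range of u must serve all late n, because r_n falls
  below every fixed scale. The error \<epsilon> is split in thirds, for the band \<eta>, for the
  term of order u, and for the convergence of the curvature coefficients of
  \<open>L n\<close>.\<close>

lemma imbalance_expansion:
  fixes x :: "'a::euclidean_space" and En :: "nat \<Rightarrow> 'a set"
  assumes d: "DIM('a) \<ge> 2" and def: "local_defining E x \<rho> \<phi> D\<phi> D2\<phi>" and conv: "convC En E"
    and closed: "\<And>n. closed (En n)" and front: "\<And>n. x \<in> frontier (En n)" and \<epsilon>: "\<epsilon> > 0"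
  defines "c \<equiv> unit_ball_vol (real (DIM('a) - 1)) / (real DIM('a) + 1) * curv_formula (D\<phi> x) (D2\<phi> x)"
  obtains \<delta> where "0 < \<delta>" "\<delta> \<le> 1"
    "\<forall>\<^sub>F n in sequentially. \<forall>u. 0 < u \<longrightarrow> u \<le> \<delta> \<longrightarrow>
       \<bar>imbalance x (En n) u - c * u ^ (DIM('a) + 1)\<bar> \<le> \<epsilon> * u ^ (DIM('a) + 1)"
proof -
  define Q where "Q = D2\<phi> x"
  define \<omega> where "\<omega> = unit_ball_vol (real (DIM('a) - 1))"
  define \<kappa> where "\<kappa> = norm (gradient_of (D\<phi> x))"
  have \<omega>: "\<omega> > 0" by (simp add: \<omega>_def)
  have Dx: "D\<phi> x \<noteq> 0" using def by (simp add: local_defining_def)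
  then have \<kappa>: "\<kappa> > 0" by (simp add: \<kappa>_def gradient_of_eq_0_iff)
  obtain L where L: "L \<longlonglongrightarrow> D\<phi> x" and exp: "\<And>\<eta>. \<eta> > 0 \<Longrightarrow> \<exists>\<delta>>0. \<forall>\<^sub>F n in sequentially. \<forall>z. norm z \<le> \<delta> \<longrightarrow>
        (L n z + Q z z / 2 + \<eta> * (norm z)\<^sup>2 < 0 \<longrightarrow> x + z \<in> En n) \<and>
        (x + z \<in> En n \<longrightarrow> L n z + Q z z / 2 - \<eta> * (norm z)\<^sup>2 \<le> 0)"
    using local_expansion[OF def conv closed front] unfolding Q_def by blast
  \<comment> \<open>The factor 12 is 3 for the third of \<epsilon>, 2 from 2 \<omega>, and 2 from
    the eventual bound |grad L_n| > \<kappa>/2.\<close>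
  define \<eta> where "\<eta> = min 1 (\<epsilon> * \<kappa> / (12 * \<omega>))"
  have \<eta>: "\<eta> > 0" "\<eta> \<le> 1" using \<epsilon> \<kappa> \<omega> by (auto simp: \<eta>_def)
  have "\<eta> \<le> \<epsilon> * \<kappa> / (12 * \<omega>)" by (simp add: \<eta>_def)
  then have \<eta>\<epsilon>: "2 * \<omega> * (2 * \<eta> / \<kappa>) \<le> \<epsilon> / 3" using \<omega> \<kappa> by (simp add: field_simps)
  \<comment> \<open>Dominates (|Q|/2 + \<eta>) / |grad L_n| whenever \<eta> \<le> 1 and |grad L_n| >
    \<kappa>/2.\<close>
  define m where "m = norm Q / \<kappa> + 2 / \<kappa>"
  have m: "m > 0" unfolding m_def using \<kappa> by (intro add_nonneg_pos) auto
  obtain \<delta>0 where \<delta>0: "\<delta>0 > 0" and ev1: "\<forall>\<^sub>F n in sequentially. \<forall>z. norm z \<le> \<delta>0 \<longrightarrow>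
        (L n z + Q z z / 2 + \<eta> * (norm z)\<^sup>2 < 0 \<longrightarrow> x + z \<in> En n) \<and>
        (x + z \<in> En n \<longrightarrow> L n z + Q z z / 2 - \<eta> * (norm z)\<^sup>2 \<le> 0)"
    using exp[OF \<eta>(1)] by blast
  define \<beta> where "\<beta> = 2 * \<omega> * ((real DIM('a) + 3) * m\<^sup>2)"
  have \<beta>: "\<beta> > 0" using \<omega> m by (simp add: \<beta>_def add_nonneg_pos)
  \<comment> \<open>The entry 1/m ensures u m \<le> 1; the last entry keeps the term of order u
    below a third of \<epsilon>.\<close>
  define \<delta> where "\<delta> = min (min 1 \<delta>0) (min (1 / m) (\<epsilon> / (3 * \<beta>)))"
  have \<delta>: "0 < \<delta>" "\<delta> \<le> 1" "\<delta> \<le> \<delta>0" "\<delta> \<le> 1 / m" "\<delta> \<le> \<epsilon> / (3 * \<beta>)"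
    using \<delta>0 m \<epsilon> \<beta> by (auto simp: \<delta>_def)
  have ev2: "\<forall>\<^sub>F n in sequentially. norm (gradient_of (L n)) > \<kappa> / 2"
    using order_tendstoD(1)[OF tendsto_norm[OF tendsto_gradient_of[OF L]], of "\<kappa> / 2"] \<kappa> by (simp add: \<kappa>_def)
  have "(\<lambda>n. \<omega> / (real DIM('a) + 1) * curv_formula (L n) Q) \<longlonglongrightarrow> c"
    unfolding c_def \<omega>_def[symmetric] Q_def by (intro tendsto_mult_left tendsto_curv_formula L Dx)
  from tendstoD[OF this, of "\<epsilon> / 3"]
  have ev3: "\<forall>\<^sub>F n in sequentially. \<bar>\<omega> / (real DIM('a) + 1) * curv_formula (L n) Q - c\<bar> < \<epsilon> / 3"
    using \<epsilon> by (simp add: dist_real_def)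
  show thesis
  proof (rule that[OF \<delta>(1,2)])
    show "\<forall>\<^sub>F n in sequentially. \<forall>u. 0 < u \<longrightarrow> u \<le> \<delta> \<longrightarrow>
       \<bar>imbalance x (En n) u - c * u ^ (DIM('a) + 1)\<bar> \<le> \<epsilon> * u ^ (DIM('a) + 1)"
      using ev1 ev2 ev3
    proof (eventually_elim, intro allI impI)
      fix n u
      assume sandwich: "\<forall>z. norm z \<le> \<delta>0 \<longrightarrow>
        (L n z + Q z z / 2 + \<eta> * (norm z)\<^sup>2 < 0 \<longrightarrow> x + z \<in> En n) \<and>
        (x + z \<in> En n \<longrightarrow> L n z + Q z z / 2 - \<eta> * (norm z)\<^sup>2 \<le> 0)"
        and g: "\<kappa> / 2 < norm (gradient_of (L n))"
        and cn: "\<bar>\<omega> / (real DIM('a) + 1) * curv_formula (L n) Q - c\<bar> < \<epsilon> / 3"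
        and u: "0 < u" "u \<le> \<delta>"
      define \<kappa>n where "\<kappa>n = norm (gradient_of (L n))"
      define w where "w = u ^ (DIM('a) + 1)"
      have w: "0 \<le> w" using u by (simp add: w_def)
      have \<kappa>n: "\<kappa> / 2 < \<kappa>n" using g by (simp add: \<kappa>n_def)
      have inv_le: "1 / \<kappa>n \<le> 2 / \<kappa>" using \<kappa>n \<kappa> by (simp add: field_simps)
      have "norm Q / (2 * \<kappa>n) + \<eta> / \<kappa>n = (norm Q / 2 + \<eta>) * (1 / \<kappa>n)"
        using \<kappa>n \<kappa> by (simp add: field_simps)
      also have "\<dots> \<le> (norm Q / 2 + 1) * (2 / \<kappa>)"
        using inv_le \<eta> \<kappa>n \<kappa> by (intro mult_mono) auto
      also have "\<dots> = m" using \<kappa> by (simp add: m_def field_simps)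
      finally have m_le: "norm Q / (2 * \<kappa>n) + \<eta> / \<kappa>n \<le> m" .
      have um: "u * m \<le> 1" using mult_right_mono[of u "1 / m" m] u \<delta>(4) m by simp
      have "\<bar>imbalance x (En n) u - \<omega> / (real DIM('a) + 1) * curv_formula (L n) Q * w\<bar>
        \<le> 2 * \<omega> * (\<eta> / \<kappa>n + (real DIM('a) + 3) * u * m\<^sup>2) * w"
        unfolding \<omega>_def \<kappa>n_def w_def
      proof (rule imbalance_estimate[OF d, where \<delta> = \<delta>0])
        show "En n \<in> sets borel" using closed by (rule borel_closed)
        show "gradient_of (L n) \<noteq> 0" using g \<kappa> by auto
      qed (use \<eta> u \<delta> m_le um sandwich in \<open>auto simp: \<kappa>n_def\<close>)
      also have "\<dots> \<le> (2 * \<epsilon> / 3) * w"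
      proof (rule mult_right_mono[OF _ w])
        have "\<eta> / \<kappa>n \<le> 2 * \<eta> / \<kappa>" using mult_left_mono[OF inv_le, of \<eta>] \<eta> by (simp add: mult.commute)
        then have "2 * \<omega> * (\<eta> / \<kappa>n) \<le> 2 * \<omega> * (2 * \<eta> / \<kappa>)" using \<omega> by (intro mult_left_mono) auto
        moreover have "\<beta> * u \<le> \<epsilon> / 3"
        proof -
          have "\<beta> * u \<le> \<beta> * (\<epsilon> / (3 * \<beta>))" using u \<delta>(5) \<beta> by (intro mult_left_mono) auto
          then show ?thesis using \<beta> by simp
        qed
        moreover have "2 * \<omega> * (\<eta> / \<kappa>n + (real DIM('a) + 3) * u * m\<^sup>2) = 2 * \<omega> * (\<eta> / \<kappa>n) + \<beta> * u"
          by (simp add: \<beta>_def algebra_simps)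
        ultimately show "2 * \<omega> * (\<eta> / \<kappa>n + (real DIM('a) + 3) * u * m\<^sup>2) \<le> 2 * \<epsilon> / 3"
          using \<eta>\<epsilon> by linarith
      qed
      finally have 1: "\<bar>imbalance x (En n) u - \<omega> / (real DIM('a) + 1) * curv_formula (L n) Q * w\<bar> \<le> (2 * \<epsilon> / 3) * w" .
      have "\<bar>\<omega> / (real DIM('a) + 1) * curv_formula (L n) Q * w - c * w\<bar>
        = \<bar>\<omega> / (real DIM('a) + 1) * curv_formula (L n) Q - c\<bar> * w"
        using w by (simp only: left_diff_distrib[symmetric] abs_mult abs_of_nonneg)
      also have "\<dots> \<le> \<epsilon> / 3 * w" using cn w by (intro mult_right_mono) auto
      finally have 2: "\<bar>\<omega> / (real DIM('a) + 1) * curv_formula (L n) Q * w - c * w\<bar> \<le> \<epsilon> / 3 * w" .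
      have "\<bar>imbalance x (En n) u - c * w\<bar> \<le> (2 * \<epsilon> / 3) * w + \<epsilon> / 3 * w" using 1 2 by linarith
      then show "\<bar>imbalance x (En n) u - c * u ^ (DIM('a) + 1)\<bar> \<le> \<epsilon> * u ^ (DIM('a) + 1)"
        unfolding w_def[symmetric] by (simp add: field_simps)
    qed
  qed
qed

text \<open>Putting y = -(s - 1) ln r in exp y \<ge> 1 + y gives (r^(1-s) - 1)/(s - 1) \<ge> -ln r.
  This lower bound is free of \<open>s n\<close>, so divergence holds whatever the relative speed of
  the two sequences.\<close>

lemma beta_at_top:
  fixes r s :: "nat \<Rightarrow> real"
  assumes r: "\<And>n. 0 < r n \<and> r n < 1" and s: "\<And>n. 1 < s n" and r0: "r \<longlonglongrightarrow> 0"
  shows "filterlim (\<lambda>n. beta d (r n) (s n)) at_top sequentially"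
proof (rule filterlim_at_top_mono)
  have "filterlim r (at_right 0) sequentially"
    using r0 r less_imp_neq[of 0] by (auto simp: filterlim_at intro!: always_eventually)
  then have "filterlim (\<lambda>n. ln (r n)) at_bot sequentially" by (rule filterlim_compose[OF ln_at_0])
  then show "filterlim (\<lambda>n. - ln (r n)) at_top sequentially" by (simp add: filterlim_uminus_at_bot)
  show "\<forall>\<^sub>F n in sequentially. - ln (r n) \<le> beta d (r n) (s n)"
  proof (intro always_eventually allI)
    fix n
    define t where "t = (r n powr (1 - s n) - 1) / (s n - 1)"
    have "1 + (s n - 1) * (- ln (r n)) \<le> exp ((s n - 1) * (- ln (r n)))" by (rule exp_ge_add_one_self)
    also have "\<dots> = r n powr (1 - s n)" using r[of n] by (simp add: powr_def algebra_simps)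
    finally have t: "- ln (r n) \<le> t" using s[of n] by (simp add: t_def field_simps)
    have "0 \<le> - ln (r n)" using r[of n] by simp
    then have t0: "0 \<le> t" using t by simp
    have "1 * t \<le> (real d + s n) / (real d + 1) * t"
      using s[of n] t0 by (intro mult_right_mono) (auto simp: field_simps)
    then have "t \<le> beta d (r n) (s n)" by (simp add: beta_def t_def[symmetric] add_increasing2)
    then show "- ln (r n) \<le> beta d (r n) (s n)" using t by simp
  qed
qed

theorem theorem5p7:
  fixes r s :: "nat \<Rightarrow> real" and En :: "nat \<Rightarrow> 'a::euclidean_space set" and E :: "'a set" and x :: 'a
  assumes "DIM('a) \<ge> 2"
    and "\<And>n. 0 < r n \<and> r n < 1"
    and "\<And>n. 1 < s n"
    and "r \<longlonglongrightarrow> 0"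
    and "s \<longlonglongrightarrow> 1"
    and "\<And>n. En n \<in> classC"
    and "E \<in> classC"
    and "convC En E"
    and "\<And>n. x \<in> frontier E \<inter> frontier (En n)"
  shows "(\<lambda>n. Kcurv (s n) (r n) x (En n) / beta DIM('a) (r n) (s n))
           \<longlonglongrightarrow> unit_ball_vol (real (DIM('a) - 1)) * mean_curv x E"
proof -
  let ?d = "real DIM('a)"
  have "\<exists>K \<rho> \<phi> D\<phi> D2\<phi>. local_defining E x \<rho> \<phi> D\<phi> D2\<phi> \<and> K = curv_formula (D\<phi> x) (D2\<phi> x)"
    using assms(7) assms(9)[of 0] by (auto simp: classC_def)
  \<comment> \<open>The limit is established for every local defining function, in particular for the one selected
    by \<open>SOME\<close> in the definition of \<open>mean_curv\<close>.\<close>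
  from someI_ex[OF this] obtain \<rho> \<phi> D\<phi> D2\<phi>
    where def: "local_defining E x \<rho> \<phi> D\<phi> D2\<phi>" and K: "mean_curv x E = curv_formula (D\<phi> x) (D2\<phi> x)"
    unfolding mean_curv_def by blast
  define c where "c = unit_ball_vol (real (DIM('a) - 1)) / (?d + 1) * mean_curv x E"
  define b where "b n = beta DIM('a) (r n) (s n)" for n
  have b_top: "filterlim b at_top sequentially"
    unfolding b_def using assms(2-4) by (rule beta_at_top)
  have closed: "closed (En n)" for n using assms(6)[of n] by (auto simp: classC_def)
  have target: "unit_ball_vol (real (DIM('a) - 1)) * mean_curv x E = c * (?d + 1)"
    by (simp add: c_def add_nonneg_eq_0_iff)
  have "(\<lambda>n. Kcurv (s n) (r n) x (En n) / b n) \<longlonglongrightarrow> c * (?d + 1)"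
  proof (rule tendstoI)
    fix e :: real assume e: "e > 0"
    \<comment> \<open>The error \<epsilon> (d + 1) b_n becomes e/2 times b_n; the other half of e
      b_n absorbs the terms that stay bounded in n.\<close>
    define \<epsilon> where "\<epsilon> = e / 2 / (?d + 1)"
    have \<epsilon>: "\<epsilon> > 0" using e by (simp add: \<epsilon>_def add_nonneg_pos)
    have "?d + 1 \<noteq> 0" by linarith
    then have \<epsilon>d: "\<epsilon> * (?d + 1) = e / 2" unfolding \<epsilon>_def by (rule nonzero_eq_divide_eq[THEN iffD1]) simp
    obtain \<delta> where \<delta>: "0 < \<delta>" "\<delta> \<le> 1" and ev: "\<forall>\<^sub>F n in sequentially. \<forall>u. 0 < u \<longrightarrow> u \<le> \<delta> \<longrightarrow>
       \<bar>imbalance x (En n) u - c * u ^ (DIM('a) + 1)\<bar> \<le> \<epsilon> * u ^ (DIM('a) + 1)"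
      using imbalance_expansion[OF assms(1) def assms(8) closed _ \<epsilon>] assms(9) unfolding c_def K by blast
    \<comment> \<open>Bounds the contribution of large u uniformly over 1 < s < 2: (d + s)/s \<le> d
      + 2, and \<delta>^(-s) \<le> \<delta>^(-2) as \<delta> \<le> 1.\<close>
    define C where "C = (unit_ball_vol ?d + \<bar>c\<bar>) * (?d + 2) * \<delta> powr (- 2)"
    have "\<forall>\<^sub>F n in sequentially. s n < 2" using order_tendstoD(2)[OF assms(5), of 2] by simp
    moreover have "\<forall>\<^sub>F n in sequentially. b n > max 1 (2 * (\<bar>c\<bar> + C) / e)"
      using b_top unfolding filterlim_at_top_dense by blast
    ultimately show "\<forall>\<^sub>F n in sequentially. dist (Kcurv (s n) (r n) x (En n) / b n) (c * (?d + 1)) < e"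
      using ev
    proof eventually_elim
      case (elim n)
      then have bn: "b n > 1" "2 * (\<bar>c\<bar> + C) / e < b n" by auto
      define k where "k = Kcurv (s n) (r n) x (En n)"
      define J where "J = (?d + 1) * b n - 1"
      have "\<bar>k - c * J\<bar> \<le> \<epsilon> * J + (unit_ball_vol ?d + \<bar>c\<bar>) * (?d + s n) / s n * \<delta> powr (- s n)"
        unfolding k_def J_def b_def
        using assms(2,3) \<delta> \<epsilon> elim(3) closed by (intro Kcurv_estimate borel_closed) auto
      also have "\<dots> \<le> \<epsilon> * ((?d + 1) * b n) + C"
      proof (rule add_mono)
        show "\<epsilon> * J \<le> \<epsilon> * ((?d + 1) * b n)" using \<epsilon> by (intro mult_left_mono) (auto simp: J_def)
        have sn: "1 < s n" "s n < 2" using assms(3) elim by auto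
        have "(?d + s n) / s n \<le> (?d + s n) / 1" using sn by (intro divide_left_mono) auto
        then have "(?d + s n) / s n \<le> ?d + 2" using sn by simp
        moreover have "\<delta> powr (- s n) \<le> \<delta> powr (- 2)" using \<delta> sn by (intro powr_mono') auto
        ultimately have "(unit_ball_vol ?d + \<bar>c\<bar>) * ((?d + s n) / s n) * \<delta> powr (- s n) \<le> C"
          unfolding C_def using sn by (intro mult_mono) auto
        then show "(unit_ball_vol ?d + \<bar>c\<bar>) * (?d + s n) / s n * \<delta> powr (- s n) \<le> C" by simp
      qed
      also have "\<epsilon> * ((?d + 1) * b n) = e / 2 * b n" unfolding \<epsilon>d[symmetric] by (rule mult.assoc[symmetric])
      finally have 1: "\<bar>k - c * J\<bar> \<le> e / 2 * b n + C" .
      \<comment> \<open>The -1 in \<open>J\<close> offsets the summand 1/(d+1) of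
        \<open>beta\<close>. It costs |c|, which is why |c| joins \<open>C\<close> in the threshold
        for b_n.\<close>
      have "c * J = c * (?d + 1) * b n - c" by (simp add: J_def algebra_simps)
      then have "\<bar>k - c * (?d + 1) * b n\<bar> \<le> e / 2 * b n + C + \<bar>c\<bar>" using 1 by linarith
      moreover have "\<bar>c\<bar> + C < e / 2 * b n" using bn(2) e by (simp add: field_simps)
      ultimately have "\<bar>k - c * (?d + 1) * b n\<bar> < e * b n" by simp
      moreover have "k / b n - c * (?d + 1) = (k - c * (?d + 1) * b n) / b n"
        using bn by (simp add: diff_divide_distrib)
      ultimately have "\<bar>k / b n - c * (?d + 1)\<bar> < e"
        using bn by (simp add: abs_divide pos_divide_less_eq)
      then show ?case by (simp add: k_def dist_real_def)
    qed
  qed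
  then show ?thesis unfolding target b_def .
qed

end
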